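(* Let $\mathcal{D}$ be a separated dissection of a polygon $P$ into triangles and quadrilaterals. Then the frieze $f_{\mathcal{D}}$ is unitary if and only if $\mathcal{D}$ can be decomposed into a set of towers.
   Context: Polygons and friezes. An $n$-gon $P$ ($n\ge 3$) is convex with vertices $0,1,\dots,n-1$ in cyclic order (indices mod $n$). An arc is an unordered pair $(i,j)$ with $i\neq j$; arcs $(i,i+1)$ are boundary arcs, all others are diagonals. Two arcs $(i,j)$, $(k,\ell)$ cross if, cyclically, $i<k<j<\ell$ or $i<\ell<j<k$. A frieze on $P$ over an integral domain $R$ is a map $f:V\times V\to R$ ($V$ the vertex set) such that: $f(i,j)=0$ iff $i=j$; $f(i,i+1)=f(i,i-1)=1$; $f(i,j)=f(j,i)$; and if $(i,j)$, $(k,\ell)$ are crossing diagonals then $f(i,j)f(k,\ell)=f(i,\ell)f(j,k)+f(i,k)f(j,\ell)$ (Ptolemy relation). Friezes from dissections. A dissection $\mathcal{D}$ of $P$ is a set of pairwise non-crossing diagonals of $P$; here all dissections divide $P$ into triangles and quadrilaterals (the subpolygons). The frieze $f_{\mathcal{D}}$ is the frieze on $P$ over $\mathbb{Z}[\sqrt2]$ with $f_{\mathcal{D}}=1$ on every edge of every subpolygon and $f_{\mathcal{D}}=\sqrt2$ on both diagonals of every quadrilateral subpolygon; the other values are determined by iterating the Ptolemy relation. Separated. A dissection $\mathcal{D}$ of $P$ into triangles and quadrilaterals is separated if (1) there is only one arc, $\tau_a$, in $\mathcal{D}$ which borders both a triangle and a quadrilateral, and (2) the quadrilateral incident to this arc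 has sides $\tau_a,\tau_b,\tau_c,\tau_d$ in clockwise order such that $\tau_b$ and $\tau_d$ are boundary edges of $P$. Unitary. A frieze $f$ on $P$ over $R$ is unitary if there is a triangulation $\{\tau_1,\dots,\tau_m\}$ of $P$ (a maximal set of pairwise non-crossing diagonals) with $f(\tau_i)\in R^\times$ for all $i$. Towers. For $n\ge 0$, an $n$-tower is a dissection of a $(2n+3)$-gon consisting of one triangle and $n$ quadrilaterals such that no vertex is incident to more than two subpolygons (a straight row of $n$ quadrilaterals with a triangle at one end; a $0$-tower is a triangle). A dissection $\mathcal{D}$ of $P$ can be decomposed into a set of towers if $P$ can be decomposed, along arcs of $\mathcal{D}$, into a set of subpolygons such that $\mathcal{D}$ restricted to each of them is a tower. *)

theory Defs
  imports Complex_Main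
begin

typedef zsqrt2 = "{x::real. \<exists>a b::int. x = of_int a + of_int b * sqrt 2}"
  morphisms real_of_zsqrt2 Abs_zsqrt2
  by (rule exI[of _ 0], simp, rule exI[of _ 0], rule exI[of _ 0], simp)

setup_lifting type_definition_zsqrt2

instantiation zsqrt2 :: idom
begin

lift_definition zero_zsqrt2 :: zsqrt2 is 0
  by (rule exI[of _ 0], rule exI[of _ 0]) simp

lift_definition one_zsqrt2 :: zsqrt2 is 1
  by (rule exI[of _ 1], rule exI[of _ 0]) simp

lift_definition plus_zsqrt2 :: "zsqrt2 \<Rightarrow> zsqrt2 \<Rightarrow> zsqrt2" is "(+)"
proof clarify
  fix a b c d :: int
  show "\<exists>e g::int. of_int a + of_int b * sqrt 2 + (of_int c + of_int d * sqrt 2)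
                   = of_int e + of_int g * sqrt 2"
    by (rule exI[of _ "a + c"], rule exI[of _ "b + d"]) (simp add: algebra_simps)
qed

lift_definition minus_zsqrt2 :: "zsqrt2 \<Rightarrow> zsqrt2 \<Rightarrow> zsqrt2" is "(-)"
proof clarify
  fix a b c d :: int
  show "\<exists>e g::int. of_int a + of_int b * sqrt 2 - (of_int c + of_int d * sqrt 2)
                   = of_int e + of_int g * sqrt 2"
    by (rule exI[of _ "a - c"], rule exI[of _ "b - d"]) (simp add: algebra_simps)
qed

lift_definition uminus_zsqrt2 :: "zsqrt2 \<Rightarrow> zsqrt2" is uminus
proof clarify
  fix a b :: int
  show "\<exists>e g::int. - (of_int a + of_int b * sqrt 2) = of_int e + of_int g * sqrt 2"
    by (rule exI[of _ "- a"], rule exI[of _ "- b"]) simp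
qed

lift_definition times_zsqrt2 :: "zsqrt2 \<Rightarrow> zsqrt2 \<Rightarrow> zsqrt2" is "(*)"
proof clarify
  fix a b c d :: int
  show "\<exists>e g::int. (of_int a + of_int b * sqrt 2) * (of_int c + of_int d * sqrt 2)
                   = of_int e + of_int g * sqrt 2"
    by (rule exI[of _ "a * c + 2 * b * d"], rule exI[of _ "a * d + b * c"])
       (simp add: algebra_simps)
qed

instance
  by standard (transfer; simp add: algebra_simps)+

end

lift_definition sqrt2 :: zsqrt2 is "sqrt 2"
  by (rule exI[of _ 0], rule exI[of _ 1]) simp

text \<open>
  A convex polygon is represented by its finite set \<open>V\<close> of vertices, which are natural numbers
  in the cyclic order induced by \<open><\<close>. The \<open>n\<close>-gon is \<open>{..<n}\<close>, and the polygon spanned by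
  some of the vertices of \<open>V\<close> is simply a subset of \<open>V\<close>.
\<close>

definition cyclic3 :: "nat \<Rightarrow> nat \<Rightarrow> nat \<Rightarrow> bool" where
  "cyclic3 i j k \<longleftrightarrow> i < j \<and> j < k \<or> j < k \<and> k < i \<or> k < i \<and> i < j"

definition cyclic4 :: "nat \<Rightarrow> nat \<Rightarrow> nat \<Rightarrow> nat \<Rightarrow> bool" where
  "cyclic4 i j k l \<longleftrightarrow>
     i < j \<and> j < k \<and> k < l \<or> j < k \<and> k < l \<and> l < i \<or>
     k < l \<and> l < i \<and> i < j \<or> l < i \<and> i < j \<and> j < k"

definition arcs :: "nat set \<Rightarrow> nat set set" where
  "arcs V = {{i, j} | i j. i \<in> V \<and> j \<in> V \<and> i \<noteq> j}"

text \<open>The arc \<open>{i, j}\<close> is a boundary arc if no vertex lies strictly between \<open>i\<close> and \<open>j\<close>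
  when going round from \<open>i\<close> to \<open>j\<close>, for one of the two orderings of its endpoints.\<close>

definition boundary_arcs :: "nat set \<Rightarrow> nat set set" where
  "boundary_arcs V = {{i, j} | i j. i \<in> V \<and> j \<in> V \<and> i \<noteq> j \<and> \<not> (\<exists>k\<in>V. cyclic3 i k j)}"

definition diagonals :: "nat set \<Rightarrow> nat set set" where
  "diagonals V = arcs V - boundary_arcs V"

lemma boundary_arcs_lessThan:
  assumes "n \<ge> 3"
  shows "boundary_arcs {..<n} = {{i, (i + 1) mod n} | i. i < n}"
proof (intro set_eqI iffI)
  fix a assume "a \<in> boundary_arcs {..<n}"
  then obtain i j where a: "a = {i, j}" "i < n" "j < n" "i \<noteq> j"
      and no: "\<And>k. k < n \<Longrightarrow> \<not> cyclic3 i k j"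
    unfolding boundary_arcs_def by blast
  have "j = (i + 1) mod n"
  proof (rule ccontr)
    assume ne: "j \<noteq> (i + 1) mod n"
    have "(i + 1) mod n = (if i + 1 = n then 0 else i + 1)"
      using a(2) by auto
    then have "cyclic3 i ((i + 1) mod n) j"
      using ne a assms unfolding cyclic3_def by (auto split: if_splits)
    then show False using no[of "(i + 1) mod n"] assms by auto
  qed
  then show "a \<in> {{i, (i + 1) mod n} | i. i < n}" using a by blast
next
  fix a assume "a \<in> {{i, (i + 1) mod n} | i. i < n}"
  then obtain i where a: "a = {i, (i + 1) mod n}" "i < n" by blast
  have m: "(i + 1) mod n = (if i + 1 = n then 0 else i + 1)" using a(2) by auto
  have "i \<noteq> (i + 1) mod n" "(i + 1) mod n < n" using m a assms by (auto split: if_splits)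
  moreover have "\<not> (\<exists>k\<in>{..<n}. cyclic3 i k ((i + 1) mod n))"
    using a(2) unfolding m cyclic3_def by (auto split: if_splits)
  ultimately show "a \<in> boundary_arcs {..<n}"
    unfolding boundary_arcs_def a(1) using a(2) by blast
qed

definition crossing :: "nat set \<Rightarrow> nat set \<Rightarrow> bool" where
  "crossing a b \<longleftrightarrow>
     (\<exists>i j k l. a = {i, j} \<and> b = {k, l} \<and> (cyclic4 i k j l \<or> cyclic4 i l j k))"

definition dissection :: "nat set \<Rightarrow> nat set set \<Rightarrow> bool" where
  "dissection V D \<longleftrightarrow> D \<subseteq> diagonals V \<and> (\<forall>a\<in>D. \<forall>b\<in>D. \<not> crossing a b)"

text \<open>A vertex set spans one of the pieces iff all its sides are arcs of the dissection or of the
  boundary and no arc of the dissection subdivides it.\<close>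

definition subpolygons :: "nat set \<Rightarrow> nat set set \<Rightarrow> nat set set" where
  "subpolygons V D =
     {W. W \<subseteq> V \<and> card W \<ge> 3 \<and> boundary_arcs W \<subseteq> D \<union> boundary_arcs V \<and> diagonals W \<inter> D = {}}"

definition triangles :: "nat set \<Rightarrow> nat set set \<Rightarrow> nat set set" where
  "triangles V D = {W \<in> subpolygons V D. card W = 3}"

definition quadrilaterals :: "nat set \<Rightarrow> nat set set \<Rightarrow> nat set set" where
  "quadrilaterals V D = {W \<in> subpolygons V D. card W = 4}"

definition tq_dissection :: "nat set \<Rightarrow> nat set set \<Rightarrow> bool" where
  "tq_dissection V D \<longleftrightarrow>
     dissection V D \<and> subpolygons V D = triangles V D \<union> quadrilaterals V D"

definition triangulation :: "nat set \<Rightarrow> nat set set \<Rightarrow> bool" where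
  "triangulation V T \<longleftrightarrow> dissection V T \<and> (\<forall>T'. dissection V T' \<and> T \<subseteq> T' \<longrightarrow> T' = T)"

definition separated :: "nat set \<Rightarrow> nat set set \<Rightarrow> bool" where
  "separated V D \<longleftrightarrow>
     (\<exists>\<tau>\<^sub>a.
        {a \<in> D. (\<exists>W\<in>triangles V D. a \<in> boundary_arcs W) \<and>
                (\<exists>Q\<in>quadrilaterals V D. a \<in> boundary_arcs Q)} = {\<tau>\<^sub>a} \<and>
        (\<forall>Q\<in>quadrilaterals V D. \<tau>\<^sub>a \<in> boundary_arcs Q \<longrightarrow>
           (\<exists>p q r s. Q = {p, q, r, s} \<and> cyclic4 p q r s \<and> \<tau>\<^sub>a = {p, q} \<and>
              {q, r} \<in> boundary_arcs V \<and> {s, p} \<in> boundary_arcs V)))"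

definition frieze :: "nat set \<Rightarrow> (nat \<Rightarrow> nat \<Rightarrow> 'a::idom) \<Rightarrow> bool" where
  "frieze V f \<longleftrightarrow>
     (\<forall>i\<in>V. \<forall>j\<in>V. f i j = 0 \<longleftrightarrow> i = j) \<and>
     (\<forall>i j. {i, j} \<in> boundary_arcs V \<longrightarrow> f i j = 1) \<and>
     (\<forall>i\<in>V. \<forall>j\<in>V. f i j = f j i) \<and>
     (\<forall>i j k l. {i, j} \<in> diagonals V \<and> {k, l} \<in> diagonals V \<and> crossing {i, j} {k, l} \<longrightarrow>
        f i j * f k l = f i l * f j k + f i k * f j l)"

definition unitary :: "nat set \<Rightarrow> (nat \<Rightarrow> nat \<Rightarrow> 'a::idom) \<Rightarrow> bool" where
  "unitary V f \<longleftrightarrow> (\<exists>T. triangulation V T \<and> (\<forall>i j. {i, j} \<in> T \<longrightarrow> f i j dvd 1))"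

text \<open>A frieze on \<open>V\<close> only matters on \<open>V \<times> V\<close>; it is set to \<open>0\<close>
  elsewhere to make the description definite.\<close>

definition frieze_of :: "nat set \<Rightarrow> nat set set \<Rightarrow> nat \<Rightarrow> nat \<Rightarrow> zsqrt2" where
  "frieze_of V D =
     (THE f. frieze V f \<and>
        (\<forall>W\<in>subpolygons V D. \<forall>i j. {i, j} \<in> boundary_arcs W \<longrightarrow> f i j = 1) \<and>
        (\<forall>Q\<in>quadrilaterals V D. \<forall>i j. {i, j} \<in> diagonals Q \<longrightarrow> f i j = sqrt2) \<and>
        (\<forall>i j. i \<notin> V \<or> j \<notin> V \<longrightarrow> f i j = 0))"

definition tower :: "nat \<Rightarrow> nat set \<Rightarrow> nat set set \<Rightarrow> bool" where
  "tower m V D \<longleftrightarrow>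
     finite V \<and> card V = 2 * m + 3 \<and> tq_dissection V D \<and>
     card (triangles V D) = 1 \<and> card (quadrilaterals V D) = m \<and>
     (\<forall>v\<in>V. card {W \<in> subpolygons V D. v \<in> W} \<le> 2)"

text \<open>Decomposing the polygon along the arcs in \<open>E \<subseteq> D\<close> yields the polygons in
  \<open>subpolygons V E\<close>.\<close>

definition tower_decomposable :: "nat set \<Rightarrow> nat set set \<Rightarrow> bool" where
  "tower_decomposable V D \<longleftrightarrow>
     (\<exists>E\<subseteq>D. \<forall>W\<in>subpolygons V E. \<exists>m. tower m W (D \<inter> diagonals W))"

end

theory Submission
  imports Defs
begin

text \<open>
  Cut the polygon along the arc \<open>{u, v}\<close> that borders both a triangle and a quadrilateral. As no
  other arc is mixed, one side is cut into quadrilaterals only and the other into triangles only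
  (\<open>separated_cut\<close>). Both properties in the theorem turn out to be conditions on the
  quadrangulated side alone, and to be controlled by the function \<open>h(y) = f(y, u) + f(y, v)\<close> on
  its vertices: \<open>f\<close> is unitary iff all values of \<open>h\<close> are units, iff the quadrilaterals form a
  straight row starting at \<open>{u, v}\<close>, iff the dissection can be decomposed into towers.

  Units and rows (\<open>row_iff_units\<close>). Let \<open>u, p, q, v\<close> be the quadrilateral at \<open>{u, v}\<close>. Beyond its
  opposite side \<open>{p, q}\<close>, the function \<open>h\<close> is \<open>1 + \<surd>2\<close> times the corresponding function for
  \<open>{p, q}\<close>, and \<open>1 + \<surd>2\<close> is a unit; so a straight row gives only units. If instead a further
  quadrilateral is attached to one of the lateral sides, \<open>h\<close> takes there the value \<open>1 + 2\<surd>2\<close>, of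
  norm \<open>-7\<close>. Peeling off quadrilaterals proves the equivalence by induction.

  Unitarity and units. If \<open>h\<close> has unit values, the arcs of \<open>D\<close> among the triangles together with
  the fan that joins the apex \<open>x\<close> of the triangle at \<open>{u, v}\<close> to the quadrangulated side form
  a triangulation by units, because \<open>f(x, y) = h(y)\<close>. For the converse take a triangulation
  \<open>T\<close> by units. On the quadrangulated side the vertices can be two-coloured such that values
  between equal colours are integer multiples of \<open>\<surd>2\<close> and hence no units, so no triangle of
  \<open>T\<close> lies in that side, and every edge of that side except \<open>{u, v}\<close> is joined in \<open>T\<close> to an apex
  among the triangulated vertices. The edges \<open>{u, p}\<close> and \<open>{q, v}\<close> belong to the polygon since \<open>D\<close> is
  separated. Values among the triangulated vertices are positive integers, and an integer
  \<open>a > 0\<close> makes \<open>a\<close> or \<open>a + \<surd>2\<close> a unit only for \<open>a = 1\<close>; this forces the apices \<open>z\<close> of both edges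
  to satisfy \<open>f(z, u) = f(z, v) = 1\<close>. There is only one such \<open>z\<close>, and as arcs of \<open>T\<close> do not cross,
  \<open>z\<close> is joined in \<open>T\<close> to every vertex strictly between \<open>p\<close> and \<open>q\<close>. Thus \<open>h(y) = f(z, y)\<close>
  is a unit throughout.

  Decomposability and rows. Every tower contains a triangle, so a decomposition into towers cannot
  use \<open>{u, v}\<close> or an arc of the quadrangulated side; all quadrilaterals lie in one tower,
  which makes them a row. Conversely a row and the triangle at \<open>{u, v}\<close> form a tower, and
  all other triangles are towers by themselves.

  The frieze of a dissection is given by a definite description, so its existence and uniqueness
  have to be established as well. Uniqueness follows by computing the values across each arc with
  the Ptolemy relation. For existence the values are taken to be the determinants \<open>det(w\<^sub>i, w\<^sub>j)\<close> of
  vectors attached to the vertices, for which the Ptolemy relation is the Pluecker relation.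
\<close>

section \<open>Arithmetic of the ring generated by the square root of two\<close>

lemmas real_of_zsqrt2_simps =
  zero_zsqrt2.rep_eq one_zsqrt2.rep_eq plus_zsqrt2.rep_eq minus_zsqrt2.rep_eq
  uminus_zsqrt2.rep_eq times_zsqrt2.rep_eq sqrt2.rep_eq

lemma real_of_zsqrt2_of_int [simp]: "real_of_zsqrt2 (of_int k) = of_int k"
proof -
  have nat: "real_of_zsqrt2 (of_nat n) = of_nat n" for n
    by (induction n) (simp_all add: real_of_zsqrt2_simps)
  show ?thesis
    by (cases k rule: int_cases2) (simp_all add: real_of_zsqrt2_simps nat)
qed

lemma zsqrt2_cases:
  obtains a b where "x = of_int a + of_int b * sqrt2"
proof -
  obtain a b where "real_of_zsqrt2 x = of_int a + of_int b * sqrt 2"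
    using real_of_zsqrt2[of x] by blast
  then have "real_of_zsqrt2 x = real_of_zsqrt2 (of_int a + of_int b * sqrt2)"
    by (simp add: real_of_zsqrt2_simps)
  then show ?thesis using that real_of_zsqrt2_inject by blast
qed

lemma sqrt2_sqrt2: "sqrt2 * sqrt2 = 2"
proof -
  have "real_of_zsqrt2 (sqrt2 * sqrt2) = real_of_zsqrt2 (of_int 2)"
    unfolding real_of_zsqrt2_of_int by (simp add: real_of_zsqrt2_simps)
  then show ?thesis by (simp add: real_of_zsqrt2_inject)
qed

lemma square_eq_two_squares_nat: "(a::nat)^2 = 2 * b^2 \<Longrightarrow> b = 0"
proof (induction b arbitrary: a rule: less_induct)
  case (less b)
  have "even (a^2)" using less.prems by simp
  then obtain c where c: "a = 2 * c" by (auto elim: evenE)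
  then have b2: "b^2 = 2 * c^2" using less.prems by (simp add: power_mult_distrib)
  then have "even (b^2)" by simp
  then obtain d where d: "b = 2 * d" by (auto elim: evenE)
  then have "c^2 = 2 * d^2" using b2 by (simp add: power_mult_distrib)
  then show ?case using less.IH[of d c] d by (cases "b = 0") auto
qed

lemma square_eq_two_squares_int:
  assumes "(a::int)^2 = 2 * b^2"
  shows "a = 0" "b = 0"
proof -
  have "int ((nat \<bar>a\<bar>)^2) = int (2 * (nat \<bar>b\<bar>)^2)" using assms by simp
  then have "(nat \<bar>a\<bar>)^2 = 2 * (nat \<bar>b\<bar>)^2" by (simp only: of_nat_eq_iff)
  then have "nat \<bar>b\<bar> = 0" by (rule square_eq_two_squares_nat)
  then show "b = 0" by simp
  then show "a = 0" using assms by simp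
qed

text \<open>
  Irrationality of \<open>\<surd>2\<close>, which makes the coordinates of an element unique.
\<close>

lemma zsqrt2_eq_0_iff: "of_int a + of_int b * sqrt2 = 0 \<longleftrightarrow> a = 0 \<and> b = 0"
proof
  assume "of_int a + of_int b * sqrt2 = 0"
  then have "of_int a = - of_int b * sqrt2" by (simp add: eq_neg_iff_add_eq_0)
  then have "(of_int a)^2 = (of_int b)^2 * (sqrt2 * sqrt2)" by (simp add: power2_eq_square)
  then have "(of_int (a^2) :: zsqrt2) = of_int (2 * b^2)" by (simp add: sqrt2_sqrt2)
  then have "real_of_zsqrt2 (of_int (a^2)) = real_of_zsqrt2 (of_int (2 * b^2))" by simp
  then have "a^2 = 2 * b^2" unfolding real_of_zsqrt2_of_int of_int_eq_iff .
  then show "a = 0 \<and> b = 0" using square_eq_two_squares_int by blast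
qed simp

text \<open>
  The norm \<open>a\<^sup>2 - 2b\<^sup>2\<close> is multiplicative and integral, so it is \<open>\<plusminus>1\<close> on units. All proofs below that
  some value is not a unit compute this norm.
\<close>

lemma unit_norm:
  assumes "of_int a + of_int b * sqrt2 dvd 1"
  shows "\<bar>a^2 - 2 * b^2\<bar> = 1"
proof -
  obtain y where y: "1 = (of_int a + of_int b * sqrt2) * y" using assms by (rule dvdE)
  obtain c d where cd: "y = of_int c + of_int d * sqrt2" by (rule zsqrt2_cases)
  have "(of_int a + of_int b * sqrt2) * y
      = of_int (a * c) + of_int (b * d) * (sqrt2 * sqrt2) + of_int (a * d + b * c) * sqrt2"
    unfolding cd by (simp add: algebra_simps)
  then have "of_int (a * c + 2 * b * d - 1) + of_int (a * d + b * c) * sqrt2 = 0"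
    using y by (simp add: sqrt2_sqrt2 algebra_simps)
  then have "a * c + 2 * b * d - 1 = 0" "a * d + b * c = 0"
    unfolding zsqrt2_eq_0_iff by auto
  then have "(a^2 - 2 * b^2) * (c^2 - 2 * d^2) = 1" by algebra
  then show ?thesis using abs_zmult_eq_1[of "a^2 - 2 * b^2" "c^2 - 2 * d^2"] by simp
qed

lemma unit_of_int:
  assumes "(of_int a :: zsqrt2) dvd 1" "a > 0"
  shows "a = 1"
proof -
  have "\<bar>a^2\<bar> = 1" using unit_norm[of a 0] assms(1) by simp
  then show ?thesis using assms(2) by (simp add: power2_eq_1_iff)
qed

lemma not_unit_multiple_of_sqrt2: "\<not> of_int b * sqrt2 dvd 1"
proof
  assume "of_int b * sqrt2 dvd 1"
  then have "\<bar>2 * b^2\<bar> = 1" using unit_norm[of 0 b] by simp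
  then show False by presburger
qed

lemma unit_of_int_plus_sqrt2:
  assumes "of_int b + sqrt2 dvd 1" "b > 0"
  shows "b = 1"
proof (rule ccontr)
  assume "b \<noteq> 1"
  then have "b \<ge> 2" using assms(2) by simp
  then have "b * b \<ge> 2 * 2" by (intro mult_mono) auto
  moreover have "\<bar>b^2 - 2\<bar> = 1" using unit_norm[of b 1] assms(1) by simp
  ultimately show False by (simp add: power2_eq_square)
qed

lemma not_unit_1_2sqrt2: "\<not> 1 + 2 * sqrt2 dvd 1"
  using unit_norm[of 1 2] by auto

lemma unit_1_sqrt2: "1 + sqrt2 dvd 1"
proof (rule dvdI)
  show "1 = (1 + sqrt2) * (sqrt2 - 1)" using sqrt2_sqrt2 by (simp add: algebra_simps)
qed

lemma unit_mult_1_sqrt2: "(1 + sqrt2) * x dvd 1 \<longleftrightarrow> x dvd 1"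
  using unit_1_sqrt2 by (metis dvd_mult_left dvd_mult_right mult.commute mult_dvd_mono mult_1)

section \<open>Cyclic order, arcs and the two sides of a diagonal\<close>

text \<open>
  Only the order of the vertices matters. Reading them as integers turns statements about a
  bounded number of points on the circle into linear arithmetic.
\<close>

declare [[smt_nat_as_int]]

lemma cyclic3_rotate: "cyclic3 i j k \<Longrightarrow> cyclic3 j k i"
  by (auto simp: cyclic3_def)

lemma cyclic3_distinct: "cyclic3 i j k \<Longrightarrow> i \<noteq> j \<and> j \<noteq> k \<and> i \<noteq> k"
  by (auto simp: cyclic3_def)

lemma cyclic3_asym: "cyclic3 i j k \<Longrightarrow> \<not> cyclic3 k j i"
  by (auto simp: cyclic3_def)

lemma cyclic3_total: "i \<noteq> j \<Longrightarrow> j \<noteq> k \<Longrightarrow> i \<noteq> k \<Longrightarrow> cyclic3 i j k \<or> cyclic3 k j i"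
  by (auto simp: cyclic3_def)

lemma cyclic4_iff: "cyclic4 i j k l \<longleftrightarrow> cyclic3 i j k \<and> cyclic3 k l i"
  by (auto simp: cyclic3_def cyclic4_def)

lemma crossing_iff:
  "crossing {i, j} {k, l} \<longleftrightarrow>
     cyclic3 i k j \<and> cyclic3 j l i \<or> cyclic3 i l j \<and> cyclic3 j k i"
  unfolding crossing_def cyclic4_iff by (auto simp: doubleton_eq_iff)

lemma boundary_arcs_iff:
  "{i, j} \<in> boundary_arcs V \<longleftrightarrow>
     i \<in> V \<and> j \<in> V \<and> i \<noteq> j \<and> (\<not> (\<exists>k\<in>V. cyclic3 i k j) \<or> \<not> (\<exists>k\<in>V. cyclic3 j k i))"
  unfolding boundary_arcs_def by (auto simp: doubleton_eq_iff)

lemma boundary_arcs_I: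
  "i \<in> V \<Longrightarrow> j \<in> V \<Longrightarrow> i \<noteq> j \<Longrightarrow> (\<And>k. k \<in> V \<Longrightarrow> \<not> cyclic3 i k j) \<Longrightarrow> {i, j} \<in> boundary_arcs V"
  unfolding boundary_arcs_iff by blast

lemma not_boundary_arcs_I:
  "k \<in> V \<Longrightarrow> cyclic3 i k j \<Longrightarrow> l \<in> V \<Longrightarrow> cyclic3 j l i \<Longrightarrow> {i, j} \<notin> boundary_arcs V"
  unfolding boundary_arcs_iff by blast

lemma diagonals_iff:
  "{i, j} \<in> diagonals V \<longleftrightarrow>
     i \<in> V \<and> j \<in> V \<and> (\<exists>k\<in>V. cyclic3 i k j) \<and> (\<exists>k\<in>V. cyclic3 j k i)"
proof -
  have "{i, j} \<in> arcs V \<longleftrightarrow> i \<in> V \<and> j \<in> V \<and> i \<noteq> j"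
    unfolding arcs_def by (auto simp: doubleton_eq_iff)
  then show ?thesis
    unfolding diagonals_def Diff_iff boundary_arcs_iff using cyclic3_distinct by blast
qed

lemma diagonals_iff_not_boundary:
  "{i, j} \<in> diagonals V \<longleftrightarrow> i \<in> V \<and> j \<in> V \<and> i \<noteq> j \<and> {i, j} \<notin> boundary_arcs V"
  unfolding diagonals_iff boundary_arcs_iff using cyclic3_distinct by blast

lemma diagonal_endpoints:
  assumes "{u, v} \<in> diagonals V"
  shows "u \<in> V" "v \<in> V" "u \<noteq> v"
  using assms unfolding diagonals_iff_not_boundary by blast+

lemma arc_disj: "i \<in> V \<Longrightarrow> j \<in> V \<Longrightarrow> i \<noteq> j \<Longrightarrow> {i, j} \<in> diagonals V \<or> {i, j} \<in> boundary_arcs V"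
  by (auto simp: diagonals_iff_not_boundary)

lemma diagonals_not_boundary: "a \<in> diagonals V \<Longrightarrow> a \<notin> boundary_arcs V"
  by (auto simp: diagonals_def)

lemma diagonalE:
  assumes "a \<in> diagonals V"
  obtains i j where "a = {i, j}" "i \<in> V" "j \<in> V" "i \<noteq> j" "{i, j} \<in> diagonals V"
  using assms unfolding diagonals_def arcs_def by blast

lemma boundaryE:
  assumes "a \<in> boundary_arcs V"
  obtains i j where "a = {i, j}" "i \<in> V" "j \<in> V" "i \<noteq> j" "{i, j} \<in> boundary_arcs V"
    "\<And>k. k \<in> V \<Longrightarrow> \<not> cyclic3 i k j"
  using assms unfolding boundary_arcs_def by blast

lemma diagonals_mono:
  assumes "W \<subseteq> V"
  shows "diagonals W \<subseteq> diagonals V"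
proof
  fix a assume "a \<in> diagonals W"
  then obtain i j where a: "a = {i, j}" "{i, j} \<in> diagonals W" by (rule diagonalE)
  show "a \<in> diagonals V" using a(2) assms unfolding a(1) diagonals_iff by blast
qed

lemma boundary_arcs_antimono: "W \<subseteq> V \<Longrightarrow> i \<in> W \<Longrightarrow> j \<in> W \<Longrightarrow>
    {i, j} \<in> boundary_arcs V \<Longrightarrow> {i, j} \<in> boundary_arcs W"
  unfolding boundary_arcs_iff by blast

lemma crossing_diagonals:
  assumes "crossing {i, j} {k, l}" "{i, j, k, l} \<subseteq> V"
  shows "{i, j} \<in> diagonals V" "{k, l} \<in> diagonals V"
proof -
  have "cyclic3 i k j \<and> cyclic3 j l i \<and> cyclic3 l i k \<and> cyclic3 k j l \<or>
    cyclic3 i l j \<and> cyclic3 j k i \<and> cyclic3 k i l \<and> cyclic3 l j k"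
    using assms(1) unfolding crossing_iff cyclic3_def by (smt (verit))
  then show "{i, j} \<in> diagonals V" "{k, l} \<in> diagonals V"
    using assms(2) unfolding diagonals_iff by auto
qed

text \<open>
  The closed cyclic interval from \<open>u\<close> to \<open>v\<close>. The two sides of the diagonal \<open>{u, v}\<close> are
  \<open>side V u v\<close> and \<open>side V v u\<close>; distinguishing them by the orientation of the arc lets
  every statement about one side apply to the other by exchanging \<open>u\<close> and \<open>v\<close>.
\<close>

definition side :: "nat set \<Rightarrow> nat \<Rightarrow> nat \<Rightarrow> nat set" where
  "side V u v = {x \<in> V. x = u \<or> x = v \<or> cyclic3 u x v}"

lemma side_subset: "side V u v \<subseteq> V"
  by (auto simp: side_def)

text \<open>
  An edge of the side that is no edge of the polygon skips only vertices of the other side; since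
  it cannot skip \<open>u\<close> or \<open>v\<close>, it has to be the cut itself.
\<close>

lemma boundary_arcs_side:
  assumes "{u, v} \<in> diagonals V"
  shows "{i, j} \<in> boundary_arcs (side V u v) \<longleftrightarrow>
    {i, j} = {u, v} \<or> {i, j} \<in> boundary_arcs V \<and> i \<in> side V u v \<and> j \<in> side V u v"
proof -
  have uv: "u \<in> V" "v \<in> V" "u \<noteq> v"
    using diagonal_endpoints assms by metis+
  have key: "{i, j} = {u, v} \<or> \<not> (\<exists>k\<in>V. cyclic3 i k j)"
    if "i \<in> side V u v" "j \<in> side V u v" "i \<noteq> j" "\<not> (\<exists>k\<in>side V u v. cyclic3 i k j)" for i j
  proof (rule ccontr)
    assume c: "\<not> ?thesis"
    then obtain k where k: "k \<in> V" "cyclic3 i k j" by blast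
    then have "\<not> cyclic3 u k v" "k \<noteq> u" "k \<noteq> v"
      using that uv by (auto simp: side_def)
    moreover have "\<not> cyclic3 i u j" "\<not> cyclic3 i v j"
      using that uv by (auto simp: side_def)
    moreover have "i = u \<or> i = v \<or> cyclic3 u i v" "j = u \<or> j = v \<or> cyclic3 u j v"
      using that by (auto simp: side_def)
    moreover have "\<not> (i = u \<and> j = v)" "\<not> (i = v \<and> j = u)"
      using c by auto
    ultimately show False using k(2) that(3) uv(3)
      unfolding cyclic3_def by (smt (verit))
  qed
  have "{u, v} \<in> boundary_arcs (side V u v)"
    using uv cyclic3_asym cyclic3_distinct unfolding boundary_arcs_iff side_def by blast
  moreover have "{i, j} \<in> boundary_arcs (side V u v)"
    if "{i, j} \<in> boundary_arcs V" "i \<in> side V u v" "j \<in> side V u v"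
    using that boundary_arcs_antimono[OF side_subset] by auto
  moreover have "{i, j} = {u, v} \<or> {i, j} \<in> boundary_arcs V"
    if "{i, j} \<in> boundary_arcs (side V u v)"
    using that key[of i j] key[of j i] side_subset[of V u v]
    unfolding boundary_arcs_iff by blast
  moreover have "i \<in> side V u v \<and> j \<in> side V u v" if "{i, j} \<in> boundary_arcs (side V u v)"
    using that unfolding boundary_arcs_iff by blast
  ultimately show ?thesis by metis
qed

lemma diagonals_side:
  assumes "{u, v} \<in> diagonals V"
  shows "{i, j} \<in> diagonals (side V u v) \<longleftrightarrow>
    {i, j} \<noteq> {u, v} \<and> {i, j} \<in> diagonals V \<and> i \<in> side V u v \<and> j \<in> side V u v"
  unfolding diagonals_iff_not_boundary[of i j] boundary_arcs_side[OF assms]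
  using side_subset[of V u v] by blast

lemma side_Un:
  assumes "{u, v} \<in> diagonals V"
  shows "side V u v \<union> side V v u = V" "side V u v \<inter> side V v u = {u, v}"
proof -
  have "u \<noteq> v" "u \<in> V" "v \<in> V" using diagonal_endpoints assms by metis+
  then show "side V u v \<union> side V v u = V" "side V u v \<inter> side V v u = {u, v}"
    using cyclic3_total[of u _ v] cyclic3_asym[of u _ v] by (auto simp: side_def) metis+
qed

lemma not_crossing_same_side:
  assumes "{u, v} \<in> diagonals V" "i \<in> V" "j \<in> V" "i \<noteq> j" "\<not> crossing {u, v} {i, j}"
  shows "i \<in> side V u v \<and> j \<in> side V u v \<or> i \<in> side V v u \<and> j \<in> side V v u"
proof -
  have uv: "u \<noteq> v" "u \<in> V" "v \<in> V" using diagonal_endpoints[OF assms(1)] by auto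
  have "\<not> (cyclic3 u i v \<and> cyclic3 v j u)" "\<not> (cyclic3 u j v \<and> cyclic3 v i u)"
    using assms(5) by (auto simp: crossing_iff)
  then show ?thesis
    using cyclic3_total[of u i v] cyclic3_total[of u j v] uv assms(2,3) by (auto simp: side_def)
qed

lemma diagonal_partition:
  assumes "{u, v} \<in> diagonals V" "a \<in> diagonals V" "\<not> crossing {u, v} a"
  shows "a = {u, v} \<or> a \<in> diagonals (side V u v) \<or> a \<in> diagonals (side V v u)"
proof -
  obtain i j where a: "a = {i, j}" "i \<in> V" "j \<in> V" "i \<noteq> j" using assms(2) by (rule diagonalE)
  have "{v, u} \<in> diagonals V" using assms(1) by (simp add: insert_commute)
  then show ?thesis
    using not_crossing_same_side[OF assms(1) a(2,3,4)] assms a(1)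
      diagonals_side[of u v V i j] diagonals_side[of v u V i j]
    by (auto simp: insert_commute)
qed

lemma card_side:
  assumes "{u, v} \<in> diagonals V" "finite V"
  shows "card (side V u v) + card (side V v u) = card V + 2"
    "3 \<le> card (side V u v)" "card (side V u v) < card V"
proof -
  have uv: "u \<noteq> v" "u \<in> V" "v \<in> V" using diagonal_endpoints assms by metis+
  have fin: "finite (side V u v)" "finite (side V v u)"
    using finite_subset[OF side_subset assms(2)] by auto
  show "card (side V u v) + card (side V v u) = card V + 2"
    using card_Un_Int[OF fin] side_Un[OF assms(1)] uv by simp
  have ge: "3 \<le> card (side V x y)" if xy: "{x, y} \<in> diagonals V" for x y
  proof -
    obtain k where k: "k \<in> V" "cyclic3 x k y" using xy unfolding diagonals_iff by blast
    then have "{x, k, y} \<subseteq> side V x y" "x \<noteq> k" "x \<noteq> y" "k \<noteq> y"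
      using diagonal_endpoints[OF xy] cyclic3_distinct[OF k(2)] by (auto simp: side_def)
    then have "card {x, k, y} = 3" "card {x, k, y} \<le> card (side V x y)"
      using assms(2) card_mono[of "side V x y" "{x, k, y}"] finite_subset[OF side_subset, of V x y]
      by auto
    then show ?thesis by simp
  qed
  show "3 \<le> card (side V u v)" using ge assms by blast
  have "{v, u} \<in> diagonals V" using assms(1) by (simp add: insert_commute)
  then have "3 \<le> card (side V v u)" using ge by blast
  then show "card (side V u v) < card V"
    using \<open>card (side V u v) + card (side V v u) = card V + 2\<close> by simp
qed

lemma subset_side_not_crossing:
  assumes "x \<in> side V a b" "y \<in> side V a b"
  shows "\<not> crossing {a, b} {x, y}"
  using assms unfolding crossing_iff side_def cyclic3_def mem_Collect_eq by (smt (verit))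

lemma opposite_sides_not_crossing:
  assumes "a \<in> side V u v" "b \<in> side V u v" "x \<in> side V v u" "y \<in> side V v u"
  shows "\<not> crossing {a, b} {x, y}"
  using assms unfolding crossing_iff side_def cyclic3_def mem_Collect_eq by (smt (verit))

lemma crossing_commute: "crossing {a, b} {x, y} \<longleftrightarrow> crossing {x, y} {a, b}"
  unfolding crossing_iff cyclic3_def by (smt (verit))

lemma side_nested:
  assumes "a \<in> side V u v" "b \<in> side V u v" "a \<noteq> b" "u \<noteq> v"
  shows "side V a b \<subseteq> side V u v \<or> side V b a \<subseteq> side V u v"
proof (rule ccontr)
  assume "\<not> ?thesis"
  then obtain x y where "x \<in> side V a b" "x \<notin> side V u v" "y \<in> side V b a" "y \<notin> side V u v"
    by blast
  then show False using assms unfolding side_def cyclic3_def mem_Collect_eq by (smt (verit))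
qed

lemma side_nested_opposite:
  assumes "a \<in> side V v u" "b \<in> side V v u" "a \<noteq> b" "u \<noteq> v"
  shows "side V u v \<subseteq> side V a b \<or> side V u v \<subseteq> side V b a"
proof (rule ccontr)
  assume "\<not> ?thesis"
  then obtain x y where "x \<in> side V u v" "x \<notin> side V a b" "y \<in> side V u v" "y \<notin> side V b a"
    by blast
  then show False using assms unfolding side_def cyclic3_def mem_Collect_eq by (smt (verit))
qed

text \<open>
  If the polygon \<open>W\<close> omits the point \<open>u\<close>, then \<open>u\<close> lies behind exactly one edge of \<open>W\<close>. This edge is the
  handle on \<open>W\<close> in the two arguments below in which a missing vertex has to be excluded.
\<close>

lemma neighbours_around:
  assumes "finite W" "card W \<ge> 2" "u \<notin> W"
  obtains w w' where "w \<in> W" "w' \<in> W" "cyclic3 w u w'" "\<And>k. k \<in> W \<Longrightarrow> \<not> cyclic3 w k w'"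
proof -
  have ne: "W \<noteq> {}" using assms by auto
  define L where "L = {x\<in>W. x < u}"
  define R where "R = {x\<in>W. u < x}"
  have fin: "finite L" "finite R" using assms by (auto simp: L_def R_def)
  define w where "w = (if L = {} then Max W else Max L)"
  define w' where "w' = (if R = {} then Min W else Min R)"
  have LR: "L \<union> R = W" using assms(3) by (auto simp: L_def R_def) (metis linorder_neqE_nat)
  have "L \<subseteq> W" "R \<subseteq> W" by (auto simp: L_def R_def)
  have w: "w \<in> W"
    using Max_in[OF assms(1) ne] Max_in[OF fin(1)] \<open>L \<subseteq> W\<close> by (cases "L = {}") (auto simp: w_def)
  have w2: "w' \<in> W"
    using Min_in[OF assms(1) ne] Min_in[OF fin(2)] \<open>R \<subseteq> W\<close> by (cases "R = {}") (auto simp: w'_def)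
  have mm: "Min W < Max W"
  proof -
    obtain a b where "a \<in> W" "b \<in> W" "a \<noteq> b"
      using assms by (metis card_2_iff' card_le_Suc0_iff_eq not_less_eq_eq numeral_2_eq_2)
    then show ?thesis using assms(1)
      by (metis Max_ge Min_le le_antisym le_trans linorder_not_le)
  qed
  have lt: "x \<in> L \<Longrightarrow> x < u" "x \<in> R \<Longrightarrow> u < x" for x by (auto simp: L_def R_def)
  have c: "cyclic3 w u w'"
  proof (cases "L = {}")
    case True
    then have "R = W" using LR by auto
    then have "w' = Min W" "w = Max W" "u < Min W" using True ne lt(2)[OF Min_in[OF fin(2)]]
      by (auto simp: w_def w'_def)
    then show ?thesis using mm by (auto simp: cyclic3_def)
  next
    case F: False
    then have w1: "w = Max L" "w < u" using lt(1)[OF Max_in[OF fin(1)]] by (auto simp: w_def)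
    show ?thesis
    proof (cases "R = {}")
      case True
      then have "L = W" using LR by auto
      then show ?thesis using w1 mm True by (auto simp: cyclic3_def w'_def)
    next
      case False
      then show ?thesis using w1 lt(2)[OF Min_in[OF fin(2) False]] by (auto simp: cyclic3_def w'_def)
    qed
  qed
  have "\<not> cyclic3 w k w'" if k: "k \<in> W" for k
  proof -
    have "k \<in> L \<or> k \<in> R" using LR k by blast
    then have "k \<le> w \<and> k < u \<or> w' \<le> k \<and> u < k"
      using Max_ge[OF fin(1), of k] Min_le[OF fin(2), of k] lt[of k] by (auto simp: w_def w'_def)
    moreover have "w < u \<or> (k \<le> w \<and> u < k)"
      using \<open>k \<in> L \<or> k \<in> R\<close> lt[of k] lt(1)[OF Max_in[OF fin(1)]] k assms(1) by (cases "L = {}") (auto simp: w_def)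
    moreover have "u < w' \<or> (w' \<le> k \<and> k < u)"
      using \<open>k \<in> L \<or> k \<in> R\<close> lt[of k] lt(2)[OF Min_in[OF fin(2)]] k assms(1) by (cases "R = {}") (auto simp: w'_def)
    ultimately show ?thesis using c unfolding cyclic3_def by (smt (verit))
  qed
  then show ?thesis using that w w2 c by blast
qed

lemma next_vertex:
  assumes "finite V" "card V \<ge> 2" "u \<in> V"
  obtains w where "w \<in> V" "w \<noteq> u" "\<And>k. k \<in> V \<Longrightarrow> \<not> cyclic3 u k w"
proof (cases "card V = 2")
  case True
  then obtain a b where "V = {a, b}" "a \<noteq> b" by (auto simp: card_2_iff)
  then show ?thesis using that[of "if u = a then b else a"] assms(3) cyclic3_distinct by (cases "u = a") auto
next
  case False
  then have "card (V - {u}) \<ge> 2" using assms by simp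
  then obtain w w' where w: "w \<in> V - {u}" "w' \<in> V - {u}" "cyclic3 w u w'"
    "\<And>k. k \<in> V - {u} \<Longrightarrow> \<not> cyclic3 w k w'"
    using neighbours_around[of "V - {u}" u] assms by (metis Diff_iff finite_Diff insertI1)
  have "\<not> cyclic3 u k w'" if "k \<in> V" for k
    using w(3) w(4)[of k] that by (auto simp: cyclic3_def)
  then show ?thesis using that[of w'] w by blast
qed

lemma third_element:
  assumes "card W \<ge> 3"
  obtains z where "z \<in> W" "z \<noteq> x" "z \<noteq> y"
proof -
  have "\<not> W \<subseteq> {x, y}"
    using assms card_mono[of "{x, y}" W] card_insert_le_m1[of 2 "{y}" x] by auto
  then show ?thesis using that by blast
qed

text \<open>
  A missing vertex \<open>u\<close> would lie behind an edge of \<open>W\<close>, with a third vertex of \<open>W\<close> on the other side of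
  that edge; so the edge would not be a boundary arc of \<open>V\<close>.
\<close>

lemma boundary_arcs_subset_imp_eq:
  assumes "finite V" "W \<subseteq> V" "card W \<ge> 3" "boundary_arcs W \<subseteq> boundary_arcs V"
  shows "W = V"
proof (rule ccontr)
  assume "W \<noteq> V"
  then obtain u where u: "u \<in> V" "u \<notin> W" using assms by blast
  obtain w w' where w: "w \<in> W" "w' \<in> W" "cyclic3 w u w'" "\<And>k. k \<in> W \<Longrightarrow> \<not> cyclic3 w k w'"
    using neighbours_around[of W u] assms(3) u(2) finite_subset[OF assms(2,1)] by auto
  then have "{w, w'} \<in> boundary_arcs W" using cyclic3_distinct[OF w(3)] by (intro boundary_arcs_I) auto
  then have b: "{w, w'} \<in> boundary_arcs V" using assms by blast
  obtain z where z: "z \<in> W" "z \<noteq> w" "z \<noteq> w'" using third_element[OF assms(3), of w w'] by blast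
  then have "cyclic3 w' z w" using w(4)[OF z(1)] cyclic3_total[of w z w'] cyclic3_distinct[OF w(3)] by auto
  then show False using b not_boundary_arcs_I[OF u(1) w(3), of z] z(1) assms(2) by auto
qed

lemma three_vertices:
  assumes "card (V::nat set) = 3"
  obtains a b c where "V = {a, b, c}" "a < b" "b < c"
proof -
  obtain x y z where "V = {x, y, z}" "x \<noteq> y" "x \<noteq> z" "y \<noteq> z"
    using assms by (auto simp: card_3_iff)
  then show ?thesis
    using that[of x y z] that[of x z y] that[of y x z] that[of y z x] that[of z x y] that[of z y x]
    by (smt (verit) insert_commute)
qed

lemma four_vertices:
  assumes "card (V::nat set) = 4"
  obtains a b c d where "V = {a, b, c, d}" "a < b" "b < c" "c < d"
proof -
  have fin: "finite V" "V \<noteq> {}" using assms by (auto simp: card_ge_0_finite)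
  define d where "d = Max V"
  have d: "d \<in> V" "\<And>x. x \<in> V \<Longrightarrow> x \<le> d" using fin by (auto simp: d_def)
  then have "card (V - {d}) = 3" using assms fin by simp
  then obtain a b c where abc: "V - {d} = {a, b, c}" "a < b" "b < c" by (rule three_vertices)
  have "c \<in> V - {d}" using abc by auto
  then have "c < d" using d(2)[of c] by auto
  moreover have "V = {a, b, c, d}" using abc(1) d(1) by blast
  ultimately show ?thesis using that abc by blast
qed

lemma quad_arcs:
  assumes "cyclic4 p q r s"
  shows "boundary_arcs {p, q, r, s} = {{p, q}, {q, r}, {r, s}, {s, p}}"
    "diagonals {p, q, r, s} = {{p, r}, {q, s}}"
proof -
  have d: "p \<noteq> q" "p \<noteq> r" "p \<noteq> s" "q \<noteq> r" "q \<noteq> s" "r \<noteq> s"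
    using assms by (auto simp: cyclic4_def)
  have c: "cyclic3 p q r" "cyclic3 r s p" "cyclic3 q r s" "cyclic3 s p q"
    using assms by (auto simp: cyclic4_def cyclic3_def)
  have no: "\<not> cyclic3 p x q \<and> \<not> cyclic3 q x r \<and> \<not> cyclic3 r x s \<and> \<not> cyclic3 s x p" 
    if "x \<in> {p, q, r, s}" for x
    using that c unfolding cyclic3_def by (smt (verit) insert_iff empty_iff)
  have b: "{p, q} \<in> boundary_arcs {p, q, r, s}" "{q, r} \<in> boundary_arcs {p, q, r, s}"
    "{r, s} \<in> boundary_arcs {p, q, r, s}" "{s, p} \<in> boundary_arcs {p, q, r, s}"
    using d no by (auto intro!: boundary_arcs_I)
  have dg: "{p, r} \<in> diagonals {p, q, r, s}" "{q, s} \<in> diagonals {p, q, r, s}"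
    using c unfolding diagonals_iff by blast+
  have all: "{x, y} \<in> {{p, q}, {q, r}, {r, s}, {s, p}} \<or> {x, y} \<in> {{p, r}, {q, s}}"
    if "x \<in> {p, q, r, s}" "y \<in> {p, q, r, s}" "x \<noteq> y" for x y
    using that by (elim insertE emptyE) (simp_all add: insert_commute doubleton_eq_iff)
  have bb: "{{p, q}, {q, r}, {r, s}, {s, p}} \<subseteq> boundary_arcs {p, q, r, s}"
    and dd: "{{p, r}, {q, s}} \<subseteq> diagonals {p, q, r, s}"
    unfolding insert_subset using b dg by simp_all
  have "boundary_arcs {p, q, r, s} \<subseteq> {{p, q}, {q, r}, {r, s}, {s, p}}"
  proof
    fix a assume a: "a \<in> boundary_arcs {p, q, r, s}"
    then obtain x y where xy: "a = {x, y}" "x \<in> {p, q, r, s}" "y \<in> {p, q, r, s}" "x \<noteq> y"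
      by (rule boundaryE)
    have "a \<notin> {{p, r}, {q, s}}" using a dd diagonals_not_boundary by (meson subsetD)
    with all[OF xy(2-4)] show "a \<in> {{p, q}, {q, r}, {r, s}, {s, p}}" unfolding xy(1) by argo
  qed
  with bb show "boundary_arcs {p, q, r, s} = {{p, q}, {q, r}, {r, s}, {s, p}}" by (rule equalityI[rotated])
  have "diagonals {p, q, r, s} \<subseteq> {{p, r}, {q, s}}"
  proof
    fix a assume a: "a \<in> diagonals {p, q, r, s}"
    then obtain x y where xy: "a = {x, y}" "x \<in> {p, q, r, s}" "y \<in> {p, q, r, s}" "x \<noteq> y"
      by (rule diagonalE)
    have "a \<notin> {{p, q}, {q, r}, {r, s}, {s, p}}" using a bb diagonals_not_boundary by (meson subsetD)
    with all[OF xy(2-4)] show "a \<in> {{p, r}, {q, s}}" unfolding xy(1) by argo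
  qed
  with dd show "diagonals {p, q, r, s} = {{p, r}, {q, s}}" by (rule equalityI[rotated])
qed

lemma triangle_no_diagonals:
  assumes "card V = 3"
  shows "diagonals V = {}"
proof -
  have False if a: "a \<in> diagonals V" for a
  proof -
    obtain i j where "a = {i, j}" using a by (rule diagonalE)
    then have "{i, j} \<in> diagonals V" using a by simp
    then have "card (side V i j) < card V" "3 \<le> card (side V i j)"
      using card_side[of i j V] assms card_ge_0_finite[of V] by auto
    then show False using assms by simp
  qed
  then show ?thesis by blast
qed

text \<open>
  Which alternative holds depends on the side of \<open>{u, v}\<close> on which the quadrilateral lies.
\<close>

lemma quad_at_side:
  assumes "card Q = 4" "{u, v} \<in> boundary_arcs Q"
  obtains p q where "Q = {u, p, q, v}" "cyclic4 u p q v \<or> cyclic4 v q p u"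
proof -
  obtain a b c d where Q: "Q = {a, b, c, d}" "a < b" "b < c" "c < d" using assms(1) by (rule four_vertices)
  then have "cyclic4 a b c d" by (auto simp: cyclic4_def)
  then have "{u, v} \<in> {{a, b}, {b, c}, {c, d}, {d, a}}" using quad_arcs(1)[of a b c d] assms(2) Q(1) by simp
  then consider "u = a" "v = b" | "u = b" "v = a" | "u = b" "v = c" | "u = c" "v = b" |
    "u = c" "v = d" | "u = d" "v = c" | "u = d" "v = a" | "u = a" "v = d"
    by (auto simp: doubleton_eq_iff)
  then show ?thesis
  proof cases
    case 1 then show ?thesis using that[of d c] Q by (auto simp: cyclic4_def)
  next
    case 2 then show ?thesis using that[of c d] Q by (auto simp: cyclic4_def)
  next
    case 3 then show ?thesis using that[of a d] Q by (auto simp: cyclic4_def)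
  next
    case 4 then show ?thesis using that[of d a] Q by (auto simp: cyclic4_def)
  next
    case 5 then show ?thesis using that[of b a] Q by (auto simp: cyclic4_def)
  next
    case 6 then show ?thesis using that[of a b] Q by (auto simp: cyclic4_def)
  next
    case 7 then show ?thesis using that[of c b] Q by (auto simp: cyclic4_def)
  next
    case 8 then show ?thesis using that[of b c] Q by (auto simp: cyclic4_def)
  qed
qed

section \<open>Cutting a dissection along one of its arcs\<close>

text \<open>
  A piece cannot straddle an arc \<open>{u, v}\<close> of the dissection. If it contains both end points, the arc would be
  one of its diagonals. If it misses an end point \<open>r\<close>, the edge of \<open>W\<close> in front of \<open>r\<close> belongs to \<open>D\<close>,
  and since it does not cross \<open>{u, v}\<close>, all of \<open>W\<close> is on one side.
\<close>

lemma subpolygon_subset_side: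
  assumes D: "dissection V D" and fin: "finite V" and uv: "{u, v} \<in> D" and W: "W \<in> subpolygons V D"
  shows "W \<subseteq> side V u v \<or> W \<subseteq> side V v u"
proof (rule ccontr)
  assume neg: "\<not> ?thesis"
  have dg: "{u, v} \<in> diagonals V" using D uv by (auto simp: dissection_def)
  have uvV: "u \<in> V" "v \<in> V" "u \<noteq> v" using diagonal_endpoints[OF dg] by auto
  have WV: "W \<subseteq> V" "card W \<ge> 3" "finite W" "boundary_arcs W \<subseteq> D \<union> boundary_arcs V" "diagonals W \<inter> D = {}"
    using W fin finite_subset by (auto simp: subpolygons_def)
  obtain x y where xy: "x \<in> W" "x \<notin> side V v u" "y \<in> W" "y \<notin> side V u v"
    using neg by blast
  then have "x \<in> V" "y \<in> V" using WV by auto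
  then have c: "cyclic3 u x v" "cyclic3 v y u"
    using xy uvV cyclic3_total[of u x v] cyclic3_total[of u y v] by (auto simp: side_def)
  have bad: False if r: "{r, s} = {u, v}" "r \<notin> W" for r s
  proof -
    obtain w w' where w: "w \<in> W" "w' \<in> W" "cyclic3 w r w'" "\<And>k. k \<in> W \<Longrightarrow> \<not> cyclic3 w k w'"
      using neighbours_around[of W r] WV(2,3) r(2) by auto
    then have b: "{w, w'} \<in> boundary_arcs W" using cyclic3_distinct[OF w(3)] by (intro boundary_arcs_I) auto
    obtain z where z: "z \<in> W" "z \<noteq> w" "z \<noteq> w'" using third_element[OF WV(2), of w w'] by blast
    then have z': "cyclic3 w' z w" using w(4)[OF z(1)] cyclic3_total[of w z w'] cyclic3_distinct[OF w(3)] by auto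
    have "r \<in> V" using r uvV by (auto simp: doubleton_eq_iff)
    then have "{w, w'} \<notin> boundary_arcs V"
      using not_boundary_arcs_I[OF _ w(3), of V z] z' z(1) WV(1) by auto
    then have "{w, w'} \<in> D" using b WV by blast
    then have "\<not> crossing {r, s} {w, w'}" using D uv r by (auto simp: dissection_def)
    moreover have "cyclic3 r x s \<and> cyclic3 s y r \<or> cyclic3 r y s \<and> cyclic3 s x r"
      using c r unfolding doubleton_eq_iff by blast
    ultimately show False
      using w(3) w(4)[OF xy(1)] w(4)[OF xy(3)] unfolding crossing_iff
      by (smt (verit) cyclic3_def)
  qed
  have "u \<in> W" "v \<in> W" using bad[of u v] bad[of v u] by auto
  then have "{u, v} \<in> diagonals W" using c xy unfolding diagonals_iff by blast
  then show False using WV uv by blast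
qed

text \<open>
  This and the next lemma say that pieces are local: the pieces of \<open>D\<close> inside a polygon \<open>W\<close> that is itself a
  piece of a coarser dissection are the pieces of the restriction of \<open>D\<close> to \<open>W\<close>.
\<close>

lemma subpolygons_restrict:
  assumes "X \<in> subpolygons V D" "X \<subseteq> W" "W \<subseteq> V"
  shows "X \<in> subpolygons W (D \<inter> diagonals W)"
proof -
  have "a \<in> D \<inter> diagonals W \<union> boundary_arcs W" if aX: "a \<in> boundary_arcs X" for a
  proof -
    obtain i j where a: "a = {i, j}" "i \<in> X" "j \<in> X" "i \<noteq> j" using aX by (rule boundaryE)
    then show ?thesis
      using arc_disj[of i W j] assms boundary_arcs_antimono[OF assms(3), of i j] aX
      unfolding subpolygons_def by blast
  qed
  then show ?thesis using assms unfolding subpolygons_def by blast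
qed

lemma subpolygons_refine:
  assumes "W \<in> subpolygons V E" "E \<subseteq> D" "X \<in> subpolygons W (D \<inter> diagonals W)"
  shows "X \<in> subpolygons V D"
proof -
  have "X \<subseteq> W" using assms by (auto simp: subpolygons_def)
  moreover have "diagonals X \<inter> D = {}"
    using diagonals_mono[OF \<open>X \<subseteq> W\<close>] assms(3) unfolding subpolygons_def by blast
  moreover have "boundary_arcs X \<subseteq> D \<union> boundary_arcs V" "card X \<ge> 3" "W \<subseteq> V"
    using assms unfolding subpolygons_def by blast+
  ultimately show ?thesis unfolding subpolygons_def by blast
qed

lemma dissection_mono: "dissection V D \<Longrightarrow> E \<subseteq> D \<Longrightarrow> dissection V E"
  unfolding dissection_def by blast

lemma dissection_restrict:
  "dissection V D \<Longrightarrow> dissection W (D \<inter> diagonals W)"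
  by (auto simp: dissection_def)

lemma side_subpolygon:
  assumes "{u, v} \<in> diagonals V" "finite V"
  shows "side V u v \<in> subpolygons V {{u, v}}"
proof -
  have "a \<in> {{u, v}} \<union> boundary_arcs V" if a: "a \<in> boundary_arcs (side V u v)" for a
  proof -
    obtain i j where "a = {i, j}" using a by (rule boundaryE)
    then show ?thesis using a boundary_arcs_side[OF assms(1), of i j] by blast
  qed
  moreover have "{u, v} \<notin> diagonals (side V u v)" using diagonals_side[OF assms(1)] by auto
  ultimately show ?thesis
    using card_side[OF assms] side_subset by (auto simp: subpolygons_def)
qed

lemma subpolygons_split:
  assumes "dissection V D" "finite V" "{u, v} \<in> D"
  shows "subpolygons V D = subpolygons (side V u v) (D \<inter> diagonals (side V u v))
                         \<union> subpolygons (side V v u) (D \<inter> diagonals (side V v u))"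
proof -
  have dg: "{u, v} \<in> diagonals V" "{v, u} \<in> diagonals V"
    using assms by (auto simp: dissection_def insert_commute)
  have "{{u, v}} \<subseteq> D" "{{v, u}} \<subseteq> D" using assms by (auto simp: insert_commute)
  note sub = this
  show ?thesis
  proof (intro equalityI subsetI)
    fix W assume W: "W \<in> subpolygons V D"
    show "W \<in> subpolygons (side V u v) (D \<inter> diagonals (side V u v))
          \<union> subpolygons (side V v u) (D \<inter> diagonals (side V v u))"
      using subpolygon_subset_side[OF assms W] subpolygons_restrict[OF W _ side_subset] by auto
  next
    fix W assume "W \<in> subpolygons (side V u v) (D \<inter> diagonals (side V u v))
          \<union> subpolygons (side V v u) (D \<inter> diagonals (side V v u))"
    then show "W \<in> subpolygons V D"
      using subpolygons_refine[OF side_subpolygon[OF dg(1) assms(2)] sub(1)]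
        subpolygons_refine[OF side_subpolygon[OF dg(2) assms(2)] sub(2)] by auto
  qed
qed

lemma subpolygons_sides_disjoint:
  assumes "{u, v} \<in> diagonals V"
  shows "subpolygons (side V u v) D1 \<inter> subpolygons (side V v u) D2 = {}"
proof -
  have "W \<notin> subpolygons (side V v u) D2" if "W \<in> subpolygons (side V u v) D1" for W
  proof
    assume "W \<in> subpolygons (side V v u) D2"
    then have "W \<subseteq> {u, v}" "card W \<ge> 3"
      using that side_Un[OF assms] unfolding subpolygons_def by blast+
    then show False using third_element[of W u v] by blast
  qed
  then show ?thesis by blast
qed

lemma subpolygons_empty:
  assumes "finite V" "card V \<ge> 3"
  shows "subpolygons V {} = {V}"
  using assms boundary_arcs_subset_imp_eq[OF assms(1)] by (auto simp: subpolygons_def)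

text \<open>
  Pieces do not nest, since an edge of the smaller piece that is not an edge of the larger one would
  be a diagonal of the larger one.
\<close>

lemma subpolygons_eq_if_subset:
  assumes "finite V" "W \<in> subpolygons V D" "W' \<in> subpolygons V D" "W \<subseteq> W'"
  shows "W = W'"
proof -
  have W': "W' \<subseteq> V" "finite W'" using assms finite_subset by (auto simp: subpolygons_def)
  have "a \<in> boundary_arcs W'" if a: "a \<in> boundary_arcs W" for a
  proof -
    obtain i j where ij: "a = {i, j}" "i \<in> W" "j \<in> W" "i \<noteq> j" using a by (rule boundaryE)
    then show ?thesis
      using arc_disj[of i W' j] boundary_arcs_antimono[OF W'(1), of i j] a assms(2-4)
      unfolding subpolygons_def by blast
  qed
  then show ?thesis
    using boundary_arcs_subset_imp_eq[OF W'(2) assms(4)] assms(2) by (auto simp: subpolygons_def)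
qed

text \<open>
  Induction along the tree of pieces: the dissection is cut at any of its arcs until nothing is left to
  cut. Facts about dissections and their friezes are proved by saying how they glue along one arc.
\<close>

lemma dissection_induct [consumes 3, case_names undivided split]:
  assumes "finite V" "card V \<ge> 3" "dissection V D"
    and base: "\<And>V. finite V \<Longrightarrow> card V \<ge> 3 \<Longrightarrow> P V {}"
    and step: "\<And>V D u v. finite V \<Longrightarrow> card V \<ge> 3 \<Longrightarrow> dissection V D \<Longrightarrow> {u, v} \<in> D \<Longrightarrow>
        P (side V u v) (D \<inter> diagonals (side V u v)) \<Longrightarrow>
        P (side V v u) (D \<inter> diagonals (side V v u)) \<Longrightarrow> P V D"
  shows "P V D"
  using assms(1-3)
proof (induction "card V" arbitrary: V D rule: less_induct)
  case less
  show ?case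
  proof (cases "D = {}")
    case True
    then show ?thesis using base less by blast
  next
    case False
    then obtain a where "a \<in> D" by blast
    then have "a \<in> diagonals V" using less.prems(3) by (auto simp: dissection_def)
    then obtain u v where "a = {u, v}" by (rule diagonalE)
    then have uv: "{u, v} \<in> D" "{u, v} \<in> diagonals V" "{v, u} \<in> diagonals V"
      using \<open>a \<in> D\<close> \<open>a \<in> diagonals V\<close> by (auto simp: insert_commute)
    show ?thesis
      using less.prems uv(1)
    proof (rule step)
      show "P (side V u v) (D \<inter> diagonals (side V u v))"
        using less.hyps[OF _ _ _ dissection_restrict[OF less.prems(3)]] card_side[OF uv(2) less.prems(1)]
          finite_subset[OF side_subset less.prems(1)] by blast
      show "P (side V v u) (D \<inter> diagonals (side V v u))"
        using less.hyps[OF _ _ _ dissection_restrict[OF less.prems(3)]] card_side[OF uv(3) less.prems(1)]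
          finite_subset[OF side_subset less.prems(1)] by blast
    qed
  qed
qed

lemma boundary_arc_in_side:
  assumes "{u, v} \<in> diagonals V" "a \<in> boundary_arcs V"
  shows "a \<in> boundary_arcs (side V u v) \<or> a \<in> boundary_arcs (side V v u)"
proof -
  have dg: "{v, u} \<in> diagonals V" using assms by (simp add: insert_commute)
  obtain i j where a: "a = {i, j}" "i \<in> V" "j \<in> V" "i \<noteq> j" using assms(2) by (rule boundaryE)
  have "\<not> crossing {u, v} {i, j}"
    using crossing_diagonals(2)[of u v i j V] diagonal_endpoints[OF assms(1)] a assms(2)
      diagonals_not_boundary by auto
  then show ?thesis
    using not_crossing_same_side[OF assms(1) a(2-4)] a assms
      boundary_arcs_side[OF assms(1), of i j] boundary_arcs_side[OF dg, of i j] by auto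
qed

lemma boundary_arc_in_subpolygon:
  assumes "finite V" "card V \<ge> 3" "dissection V D" "a \<in> boundary_arcs V"
  shows "\<exists>W\<in>subpolygons V D. a \<in> boundary_arcs W"
  using assms
proof (induction V D rule: dissection_induct)
  case (undivided V)
  then show ?case using subpolygons_empty by auto
next
  case (split V D u v)
  have "{u, v} \<in> diagonals V" using split by (auto simp: dissection_def)
  then show ?case
    using boundary_arc_in_side split.IH split.prems subpolygons_split[OF split(3,1,4)] by blast
qed

lemma piece_at_cut:
  assumes "finite V" "dissection V D" "{u, v} \<in> D"
  obtains W where "W \<in> subpolygons (side V u v) (D \<inter> diagonals (side V u v))" "{u, v} \<in> boundary_arcs W"
proof -
  have dg: "{u, v} \<in> diagonals V" using assms by (auto simp: dissection_def)
  have "{u, v} \<in> boundary_arcs (side V u v)" using boundary_arcs_side[OF dg] by simp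
  then show ?thesis
    using boundary_arc_in_subpolygon[OF finite_subset[OF side_subset assms(1)]] card_side(2)[OF dg assms(1)]
      dissection_restrict[OF assms(2)] that by metis
qed

lemma tq_dissection_iff:
  "tq_dissection V D \<longleftrightarrow> dissection V D \<and> (\<forall>W\<in>subpolygons V D. card W = 3 \<or> card W = 4)"
  unfolding tq_dissection_def triangles_def quadrilaterals_def by blast

lemma tq_dissection_side:
  assumes "tq_dissection V D" "finite V" "{u, v} \<in> D"
  shows "tq_dissection (side V u v) (D \<inter> diagonals (side V u v))"
    "tq_dissection (side V v u) (D \<inter> diagonals (side V v u))"
  using assms subpolygons_split[of V D u v] dissection_restrict unfolding tq_dissection_iff by auto

text \<open>
  At every cut the search for the piece continues in the side that contains \<open>S\<close>.
\<close>

lemma subpolygon_containing: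
  assumes "finite V" "card V \<ge> 3" "dissection V E" "S \<subseteq> V"
    "\<forall>a b. {a, b} \<in> E \<longrightarrow> S \<subseteq> side V a b \<or> S \<subseteq> side V b a"
  shows "\<exists>W\<in>subpolygons V E. S \<subseteq> W"
  using assms
proof (induction V E rule: dissection_induct)
  case (undivided V)
  then show ?case using subpolygons_empty by auto
next
  case (split V E u v)
  have res: "\<forall>a b. {a, b} \<in> E \<inter> diagonals (side V x y) \<longrightarrow> S \<subseteq> side (side V x y) a b \<or> S \<subseteq> side (side V x y) b a"
    if S: "S \<subseteq> side V x y" for x y
  proof -
    have "S \<subseteq> side (side V x y) a b" if "S \<subseteq> side V a b" for a b
      using that S unfolding side_def by blast
    then show ?thesis using split.prems(2) by blast
  qed
  have "S \<subseteq> side V u v \<or> S \<subseteq> side V v u" using split.prems(2) split(4) by blast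
  then show ?case
    using split.IH(1)[OF _ res] split.IH(2)[OF _ res] subpolygons_split[OF split(3,1,4)] by blast
qed

text \<open>
  If one side of a cut has only triangles and the other only quadrilaterals, the cut itself is mixed,
  because it borders a piece on either side.
\<close>

lemma uniform_or_mixed_arc:
  assumes "finite V" "card V \<ge> 3" "dissection V D" "tq_dissection V D"
  shows "(\<forall>W\<in>subpolygons V D. card W = 3) \<or> (\<forall>W\<in>subpolygons V D. card W = 4) \<or>
    (\<exists>a\<in>D. (\<exists>W\<in>triangles V D. a \<in> boundary_arcs W) \<and> (\<exists>Q\<in>quadrilaterals V D. a \<in> boundary_arcs Q))"
  using assms
proof (induction V D rule: dissection_induct)
  case (undivided V)
  then show ?case using subpolygons_empty by (auto simp: tq_dissection_iff)
next
  case (split V D u v)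
  let ?A = "side V u v" and ?B = "side V v u"
  let ?DA = "D \<inter> diagonals ?A" and ?DB = "D \<inter> diagonals ?B"
  let ?mixed = "\<lambda>V D. \<exists>a\<in>D. (\<exists>W\<in>triangles V D. a \<in> boundary_arcs W) \<and> (\<exists>Q\<in>quadrilaterals V D. a \<in> boundary_arcs Q)"
  note sp = subpolygons_split[OF split(3,1,4)]
  have vu: "{v, u} \<in> D" using split by (simp add: insert_commute)
  obtain X where X: "X \<in> subpolygons ?A ?DA" "{u, v} \<in> boundary_arcs X"
    using piece_at_cut[OF split(1,3,4)] .
  obtain Y where Y: "Y \<in> subpolygons ?B ?DB" "{u, v} \<in> boundary_arcs Y"
    using piece_at_cut[OF split(1,3) vu] by (metis insert_commute)
  have lift: "?mixed V D" if "?mixed ?A ?DA \<or> ?mixed ?B ?DB"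
    using that sp unfolding triangles_def quadrilaterals_def by blast
  have cut: "?mixed V D" if "card X = 3 \<and> card Y = 4 \<or> card X = 4 \<and> card Y = 3"
    using that split(4) X Y sp unfolding triangles_def quadrilaterals_def by blast
  have IH1: "(\<forall>W\<in>subpolygons ?A ?DA. card W = 3) \<or> (\<forall>W\<in>subpolygons ?A ?DA. card W = 4) \<or> ?mixed ?A ?DA"
    using split.IH(1) tq_dissection_side[OF split.prems split(1,4)] by blast
  have IH2: "(\<forall>W\<in>subpolygons ?B ?DB. card W = 3) \<or> (\<forall>W\<in>subpolygons ?B ?DB. card W = 4) \<or> ?mixed ?B ?DB"
    using split.IH(2) tq_dissection_side[OF split.prems split(1,4)] by blast
  consider "?mixed V D" | "\<forall>W\<in>subpolygons ?A ?DA. card W = 3" "\<forall>W\<in>subpolygons ?B ?DB. card W = 3"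
    | "\<forall>W\<in>subpolygons ?A ?DA. card W = 4" "\<forall>W\<in>subpolygons ?B ?DB. card W = 4"
    using IH1 IH2 lift cut X(1) Y(1) by meson
  then show ?case
  proof cases
    case 1 then show ?thesis by blast
  next
    case 2 then show ?thesis unfolding sp by blast
  next
    case 3 then show ?thesis unfolding sp by blast
  qed
qed

section \<open>Triangulations\<close>

lemma triangulation_if_all_triangles:
  assumes "finite V" "card V \<ge> 3" "dissection V D" "\<forall>W\<in>subpolygons V D. card W = 3"
  shows "triangulation V D"
  using assms
proof (induction V D rule: dissection_induct)
  case (undivided V)
  then have "card V = 3" using subpolygons_empty by auto
  then have "diagonals V = {}" by (rule triangle_no_diagonals)
  then show ?case unfolding triangulation_def dissection_def by auto
next
  case (split V D u v)
  note sp = subpolygons_split[OF split(3,1,4)]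
  have dg: "{u, v} \<in> diagonals V" using split by (auto simp: dissection_def)
  have IH: "triangulation (side V u v) (D \<inter> diagonals (side V u v))"
    "triangulation (side V v u) (D \<inter> diagonals (side V v u))"
    using split.IH split.prems sp by blast+
  have "T' \<subseteq> D" if T': "dissection V T'" "D \<subseteq> T'" for T'
  proof
    fix t assume t: "t \<in> T'"
    have "t \<in> diagonals V" "\<not> crossing {u, v} t" using T' t split(4) unfolding dissection_def by blast+
    then consider "t = {u, v}" | "t \<in> diagonals (side V u v)" | "t \<in> diagonals (side V v u)"
      using diagonal_partition[OF dg] by blast
    then show "t \<in> D"
    proof cases
      case 1 then show ?thesis using split(4) by simp
    next
      case 2
      have "T' \<inter> diagonals (side V u v) = D \<inter> diagonals (side V u v)"
        using IH(1) dissection_restrict[OF T'(1)] Int_mono[OF T'(2) order_refl]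
        unfolding triangulation_def by blast
      then show ?thesis using 2 t by blast
    next
      case 3
      have "T' \<inter> diagonals (side V v u) = D \<inter> diagonals (side V v u)"
        using IH(2) dissection_restrict[OF T'(1)] Int_mono[OF T'(2) order_refl]
        unfolding triangulation_def by blast
      then show ?thesis using 3 t by blast
    qed
  qed
  then show ?case using split(3) unfolding triangulation_def by blast
qed

lemma exists_diagonal:
  assumes "finite V" "card V \<ge> 4"
  obtains a b where "{a, b} \<in> diagonals V"
proof -
  obtain S where S: "S \<subseteq> V" "card S = 4" using obtain_subset_with_card_n[OF assms(2)] by metis
  obtain a b c d where abcd: "S = {a, b, c, d}" "a < b" "b < c" "c < d" using S(2) by (rule four_vertices)
  have "cyclic4 a b c d" using abcd by (simp add: cyclic4_def)
  then have "{a, c} \<in> diagonals S" using quad_arcs(2) abcd(1) by simp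
  then show ?thesis using that diagonals_mono[OF S(1)] by blast
qed

text \<open>
  Arcs on opposite sides of \<open>{u, v}\<close> do not cross, so whatever can be added on one side could be added to the
  whole of \<open>T\<close>.
\<close>

lemma triangulation_restrict:
  assumes "triangulation V T" "{u, v} \<in> T"
  shows "triangulation (side V u v) (T \<inter> diagonals (side V u v))"
proof -
  have T: "dissection V T" using assms by (simp add: triangulation_def)
  then have dg: "{u, v} \<in> diagonals V" using assms(2) by (auto simp: dissection_def)
  have ep: "\<exists>i j. a = {i, j} \<and> i \<in> W \<and> j \<in> W" if a: "a \<in> diagonals W" for a W
    using a diagonalE by metis
  have "T' = T \<inter> diagonals (side V u v)"
    if T': "dissection (side V u v) T'" "T \<inter> diagonals (side V u v) \<subseteq> T'" for T'
  proof -
    have T'd: "T' \<subseteq> diagonals (side V u v)" using T' by (simp add: dissection_def)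
    have no: "\<not> crossing a b \<and> \<not> crossing b a" if ab: "a \<in> T" "b \<in> T'" for a b
    proof -
      have "a \<in> diagonals V" "\<not> crossing {u, v} a" using ab(1) T assms(2) unfolding dissection_def by blast+
      then consider "a \<in> T'" | "a = {u, v}" | "a \<in> diagonals (side V v u)"
        using diagonal_partition[OF dg] T'(2) ab(1) by blast
      then show ?thesis
      proof cases
        case 1 then show ?thesis using T'(1) ab(2) unfolding dissection_def by blast
      next
        case 2
        obtain i j where "b = {i, j}" "i \<in> side V u v" "j \<in> side V u v" using ep T'd ab(2) by blast
        then show ?thesis using 2 subset_side_not_crossing crossing_commute by metis
      next
        case 3
        obtain i j where b: "b = {i, j}" "i \<in> side V u v" "j \<in> side V u v" using ep T'd ab(2) by blast
        obtain k l where "a = {k, l}" "k \<in> side V v u" "l \<in> side V v u" using ep 3 by blast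
        then show ?thesis using b opposite_sides_not_crossing crossing_commute by metis
      qed
    qed
    have "dissection V (T \<union> T')"
      using T T'(1) no diagonals_mono[OF side_subset, of V u v] unfolding dissection_def by blast
    then have "T \<union> T' = T" using assms(1) unfolding triangulation_def by blast
    then show ?thesis using T'd T'(2) by blast
  qed
  then show ?thesis using dissection_restrict[OF T] unfolding triangulation_def by blast
qed

lemma all_triangles_if_triangulation:
  assumes "finite V" "card V \<ge> 3" "dissection V T" "triangulation V T"
  shows "\<forall>W\<in>subpolygons V T. card W = 3"
  using assms
proof (induction V T rule: dissection_induct)
  case (undivided V)
  have "card V = 3"
  proof (rule ccontr)
    assume "card V \<noteq> 3"
    then obtain a b where ab: "{a, b} \<in> diagonals V" using exists_diagonal[OF undivided(1)] undivided(2) by fastforce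
    have "\<not> crossing {a, b} {a, b}" unfolding crossing_iff cyclic3_def by auto
    then have "dissection V {{a, b}}" using ab unfolding dissection_def by simp
    then show False using undivided.prems unfolding triangulation_def by blast
  qed
  then show ?case using subpolygons_empty undivided by auto
next
  case (split V T u v)
  have vu: "{v, u} \<in> T" using split by (simp add: insert_commute)
  show ?case
    using split.IH triangulation_restrict[OF split.prems split(4)] triangulation_restrict[OF split.prems vu]
      subpolygons_split[OF split(3,1,4)] by blast
qed

lemma triangulation_apex:
  assumes "finite V" "card V \<ge> 3" "triangulation V T" "{y, y'} \<in> boundary_arcs V"
  obtains z where "z \<in> V" "z \<noteq> y" "z \<noteq> y'" "{y, z} \<in> T \<union> boundary_arcs V" "{y', z} \<in> T \<union> boundary_arcs V"
proof -
  have T: "dissection V T" using assms by (simp add: triangulation_def)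
  obtain W where W: "W \<in> subpolygons V T" "{y, y'} \<in> boundary_arcs W"
    using boundary_arc_in_subpolygon[OF assms(1,2) T assms(4)] by blast
  then have W3: "card W = 3" using all_triangles_if_triangulation[OF assms(1,2) T assms(3)] by blast
  then obtain z where z: "z \<in> W" "z \<noteq> y" "z \<noteq> y'" using third_element[of W y y'] by auto
  have y: "y \<in> W" "y' \<in> W" using W(2) unfolding boundary_arcs_iff by blast+
  have "{y, z} \<in> boundary_arcs W" "{y', z} \<in> boundary_arcs W"
    using arc_disj[OF y(1) z(1)] arc_disj[OF y(2) z(1)] z triangle_no_diagonals[OF W3] by auto
  then show ?thesis using that[of z] z W(1) unfolding subpolygons_def by blast
qed

section \<open>The frieze of a dissection: Ptolemy across an arc and uniqueness\<close>

text \<open>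
  The conditions that determine the frieze of a dissection on \<open>V \<times> V\<close>. Unlike \<open>frieze_of\<close>, this
  predicate passes to the sides of a cut without changing \<open>f\<close>.
\<close>

definition dissection_frieze :: "nat set \<Rightarrow> nat set set \<Rightarrow> (nat \<Rightarrow> nat \<Rightarrow> zsqrt2) \<Rightarrow> bool" where
  "dissection_frieze V D f \<longleftrightarrow> frieze V f \<and>
     (\<forall>W\<in>subpolygons V D. \<forall>i j. {i, j} \<in> boundary_arcs W \<longrightarrow> f i j = 1) \<and>
     (\<forall>Q\<in>quadrilaterals V D. \<forall>i j. {i, j} \<in> diagonals Q \<longrightarrow> f i j = sqrt2)"

lemma dissection_frieze_D:
  assumes "dissection_frieze V D f"
  shows "\<And>i j. {i, j} \<in> boundary_arcs V \<Longrightarrow> f i j = 1"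
    "\<And>i j. i \<in> V \<Longrightarrow> j \<in> V \<Longrightarrow> f i j = f j i"
    "\<And>i. i \<in> V \<Longrightarrow> f i i = 0"
    "\<And>i j. i \<in> V \<Longrightarrow> j \<in> V \<Longrightarrow> f i j = 0 \<Longrightarrow> i = j"
    "\<And>i j k l. {i, j, k, l} \<subseteq> V \<Longrightarrow> crossing {i, j} {k, l} \<Longrightarrow> f i j * f k l = f i l * f j k + f i k * f j l"
    "\<And>W i j. W \<in> subpolygons V D \<Longrightarrow> {i, j} \<in> boundary_arcs W \<Longrightarrow> f i j = 1"
    "\<And>W i j. W \<in> subpolygons V D \<Longrightarrow> card W = 4 \<Longrightarrow> {i, j} \<in> diagonals W \<Longrightarrow> f i j = sqrt2"
  using assms crossing_diagonals[of _ _ _ _ V]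
  unfolding dissection_frieze_def frieze_def quadrilaterals_def by auto

lemma dissection_frieze_arc:
  assumes "dissection_frieze V D f" "finite V" "dissection V D" "{u, v} \<in> D"
  shows "f u v = 1"
proof -
  obtain W where "W \<in> subpolygons (side V u v) (D \<inter> diagonals (side V u v))"
    "{u, v} \<in> boundary_arcs W"
    using piece_at_cut[OF assms(2,3,4)] .
  then show ?thesis
    using dissection_frieze_D(6)[OF assms(1)] subpolygons_split[OF assms(3,2,4)] by auto
qed

lemma dissection_frieze_side:
  assumes "dissection_frieze V D f" "finite V" "dissection V D" "{u, v} \<in> D"
  shows "dissection_frieze (side V u v) (D \<inter> diagonals (side V u v)) f"
proof -
  have dg: "{u, v} \<in> diagonals V" using assms by (auto simp: dissection_def)
  have sub: "subpolygons (side V u v) (D \<inter> diagonals (side V u v)) \<subseteq> subpolygons V D"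
    using subpolygons_split[OF assms(3,2,4)] by blast
  have f1: "f u v = 1" by (rule dissection_frieze_arc[OF assms])
  have f2: "f v u = 1" using dissection_frieze_arc[OF assms(1-3), of v u] assms(4) by (simp add: insert_commute)
  have "f i j = 1" if "{i, j} \<in> boundary_arcs (side V u v)" for i j
    using that f1 f2 dissection_frieze_D(1)[OF assms(1)] unfolding boundary_arcs_side[OF dg]
    by (auto simp: doubleton_eq_iff)
  moreover have "{i, j} \<in> diagonals V" if "{i, j} \<in> diagonals (side V u v)" for i j
    using that diagonals_mono[OF side_subset] by auto
  ultimately have "frieze (side V u v) f"
    using assms(1) side_subset[of V u v] unfolding dissection_frieze_def frieze_def by (auto 4 3)
  then show ?thesis using sub assms(1) unfolding dissection_frieze_def quadrilaterals_def by auto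
qed

text \<open>
  The Ptolemy relation for \<open>{x, y}\<close> and the arc \<open>{u, v}\<close> of value 1. Stated for the closed sides it also
  covers the trivial cases in which \<open>x\<close> or \<open>y\<close> is an end point of the cut, which spares case
  distinctions later.
\<close>

lemma dissection_frieze_across:
  assumes "dissection_frieze V D f" "finite V" "dissection V D" "{u, v} \<in> D"
    "x \<in> side V u v" "y \<in> side V v u"
  shows "f x y = f x u * f y v + f x v * f y u"
proof -
  have dg: "{u, v} \<in> diagonals V" using assms by (auto simp: dissection_def)
  note uv = diagonal_endpoints[OF dg]
  have V: "x \<in> V" "y \<in> V" using assms(5,6) side_subset by blast+
  have f1: "f u v = 1" by (rule dissection_frieze_arc[OF assms(1-4)])
  note sym = dissection_frieze_D(2)[OF assms(1)]
  have z: "f u u = 0" "f v v = 0" "f v u = 1" "f y u = f u y" "f y v = f v y"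
    using dissection_frieze_D(3)[OF assms(1)] uv V f1 sym[of v u] sym[of y] by auto
  consider "x = u" | "x = v" | "y = u" | "y = v" | "cyclic3 u x v" "cyclic3 v y u"
    using assms(5,6) by (auto simp: side_def)
  then show ?thesis
  proof cases
    case 5
    then have "crossing {u, v} {x, y}" by (auto simp: crossing_iff)
    then have "f u v * f x y = f u y * f v x + f u x * f v y"
      using dissection_frieze_D(5)[OF assms(1)] V uv by auto
    then show ?thesis using f1 z sym[of u x] sym[of v x] V uv by (simp add: mult.commute add.commute)
  qed (use f1 z in simp_all)
qed

lemma dissection_frieze_unique:
  assumes "finite V" "card V \<ge> 3" "dissection V D" "tq_dissection V D"
    "dissection_frieze V D f" "dissection_frieze V D g"
  shows "\<forall>i\<in>V. \<forall>j\<in>V. f i j = g i j"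
  using assms
proof (induction V D rule: dissection_induct)
  case (undivided V)
  have W: "V \<in> subpolygons V {}" using subpolygons_empty undivided by blast
  then have c: "card V = 3 \<or> card V = 4" using undivided by (auto simp: tq_dissection_iff)
  show ?case
  proof (intro ballI)
    fix i j assume ij: "i \<in> V" "j \<in> V"
    consider "i = j" | "{i, j} \<in> boundary_arcs V" | "{i, j} \<in> diagonals V"
      using arc_disj ij by blast
    then show "f i j = g i j"
    proof cases
      case 3
      then have "card V = 4" using triangle_no_diagonals c by auto
      then show ?thesis
        using dissection_frieze_D(7)[OF undivided.prems(2) W _ 3]
          dissection_frieze_D(7)[OF undivided.prems(3) W _ 3] by simp
    next
      case 1
      then show ?thesis using ij dissection_frieze_D(3)[OF undivided.prems(2)]
          dissection_frieze_D(3)[OF undivided.prems(3)] by simp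
    next
      case 2
      then show ?thesis using dissection_frieze_D(1)[OF undivided.prems(2) 2]
          dissection_frieze_D(1)[OF undivided.prems(3) 2] by simp
    qed
  qed
next
  case (split V D u v)
  have vu: "{v, u} \<in> D" using split by (simp add: insert_commute)
  have dg: "{u, v} \<in> diagonals V" using split by (auto simp: dissection_def)
  have 1: "\<forall>i\<in>side V u v. \<forall>j\<in>side V u v. f i j = g i j"
    using split.IH(1) tq_dissection_side split dissection_frieze_side by blast
  have 2: "\<forall>i\<in>side V v u. \<forall>j\<in>side V v u. f i j = g i j"
    using split.IH(2) tq_dissection_side split dissection_frieze_side vu by blast
  have uv: "u \<in> side V u v" "v \<in> side V u v" "u \<in> side V v u" "v \<in> side V v u"
    using side_Un[OF dg] by auto
  have 3: "f x y = g x y" if "x \<in> side V u v" "y \<in> side V v u" for x y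
    using dissection_frieze_across[OF split.prems(2) split(1,3,4) that]
      dissection_frieze_across[OF split.prems(3) split(1,3,4) that] 1 2 uv that by simp
  have 4: "f y x = g y x" if "x \<in> side V u v" "y \<in> side V v u" for x y
    using 3[OF that] that dissection_frieze_D(2)[OF split.prems(2), of x y]
      dissection_frieze_D(2)[OF split.prems(3), of x y] side_subset by (metis subsetD)
  show ?case
  proof (intro ballI)
    fix i j assume "i \<in> V" "j \<in> V"
    then have "i \<in> side V u v \<or> i \<in> side V v u" "j \<in> side V u v \<or> j \<in> side V v u"
      using side_Un(1)[OF dg] by blast+
    then show "f i j = g i j" using 1 2 3 4 by blast
  qed
qed

section \<open>The frieze of a dissection: existence and positivity\<close>

text \<open>
  A frieze in vector form: the vertex \<open>i\<close> carries the vector \<open>w\<^sub>i = (p i, q i)\<close> and the value at \<open>{i, j}\<close> is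
  \<open>det(w\<^sub>i, w\<^sub>j)\<close> for \<open>i < j\<close>. Being positive as real numbers, these values are nonzero, and positivity is a
  condition that survives gluing.
\<close>

definition realizes :: "nat set \<Rightarrow> nat set set \<Rightarrow> (nat \<Rightarrow> zsqrt2) \<Rightarrow> (nat \<Rightarrow> zsqrt2) \<Rightarrow> bool" where
  "realizes V D p q \<longleftrightarrow>
     (\<forall>i\<in>V. \<forall>j\<in>V. i < j \<longrightarrow> real_of_zsqrt2 (p i * q j - p j * q i) > 0) \<and>
     (\<forall>W\<in>subpolygons V D. \<forall>i j. i < j \<and> {i, j} \<in> boundary_arcs W \<longrightarrow> p i * q j - p j * q i = 1) \<and>
     (\<forall>W\<in>subpolygons V D. \<forall>i j. card W = 4 \<and> i < j \<and> {i, j} \<in> diagonals W \<longrightarrow> p i * q j - p j * q i = sqrt2)"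

lemma realizes_triangle:
  assumes "card V = 3"
  shows "\<exists>p q. realizes V {} p q"
proof -
  obtain a b c where V: "V = {a, b, c}" "a < b" "b < c" using assms by (rule three_vertices)
  have "finite V" using V by simp
  then have sub: "subpolygons V {} = {V}" using subpolygons_empty assms by simp
  \<comment> \<open>the vectors \<open>(1, 0)\<close>, \<open>(1, 1)\<close>, \<open>(0, 1)\<close>\<close>
  define p where "p = (\<lambda>x. if x = c then 0 else (1::zsqrt2))"
  define q where "q = (\<lambda>x. if x = a then 0 else (1::zsqrt2))"
  have val: "p i * q j - p j * q i = 1" if "i \<in> V" "j \<in> V" "i < j" for i j
    using that V by (auto simp: p_def q_def)
  have "i \<in> V \<and> j \<in> V" if "{i, j} \<in> boundary_arcs V" for i j
    using that unfolding boundary_arcs_iff by blast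
  then have "realizes V {} p q"
    using val assms unfolding realizes_def sub by (auto simp: real_of_zsqrt2_simps)
  then show ?thesis by blast
qed

lemma realizes_quadrilateral:
  assumes "card V = 4"
  shows "\<exists>p q. realizes V {} p q"
proof -
  obtain a b c d where V: "V = {a, b, c, d}" "a < b" "b < c" "c < d" using assms by (rule four_vertices)
  have "finite V" using V by simp
  then have sub: "subpolygons V {} = {V}" using subpolygons_empty assms by simp
  have cyc: "cyclic4 a b c d" using V by (simp add: cyclic4_def)
  have ne: "a \<noteq> b" "a \<noteq> c" "a \<noteq> d" "b \<noteq> c" "b \<noteq> d" "c \<noteq> d" using V by auto
  \<comment> \<open>the vectors \<open>(1, 0)\<close>, \<open>(\<surd>2, 1)\<close>, \<open>(1, \<surd>2)\<close>, \<open>(0, 1)\<close>\<close>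
  define p where "p = (\<lambda>x. if x = b then sqrt2 else if x = d then 0 else 1)"
  define q where "q = (\<lambda>x. if x = c then sqrt2 else if x = a then 0 else 1)"
  have val: "p a * q b - p b * q a = 1" "p b * q c - p c * q b = 1" "p c * q d - p d * q c = 1"
    "p a * q d - p d * q a = 1" "p a * q c - p c * q a = sqrt2" "p b * q d - p d * q b = sqrt2"
    using ne by (simp_all add: p_def q_def sqrt2_sqrt2)
  have bd: "p i * q j - p j * q i = 1" if "i < j" "{i, j} \<in> boundary_arcs V" for i j
  proof -
    have "{i, j} \<in> {{a, b}, {b, c}, {c, d}, {d, a}}" using that(2) quad_arcs(1)[OF cyc] V(1) by simp
    then show ?thesis using that(1) val V by (auto simp: doubleton_eq_iff)
  qed
  have dg: "p i * q j - p j * q i = sqrt2" if "i < j" "{i, j} \<in> diagonals V" for i j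
  proof -
    have "{i, j} \<in> {{a, c}, {b, d}}" using that(2) quad_arcs(2)[OF cyc] V(1) by simp
    then show ?thesis using that(1) val V by (auto simp: doubleton_eq_iff)
  qed
  have "real_of_zsqrt2 (p i * q j - p j * q i) > 0" if "i \<in> V" "j \<in> V" "i < j" for i j
  proof -
    have "p i * q j - p j * q i = 1 \<or> p i * q j - p j * q i = sqrt2"
      using arc_disj[of i V j] bd[of i j] dg[of i j] that by auto
    then show ?thesis
      by (elim disjE) (simp_all only: one_zsqrt2.rep_eq sqrt2.rep_eq zero_less_one
          real_sqrt_gt_0_iff zero_less_numeral)
  qed
  then have "realizes V {} p q"
    using bd dg unfolding realizes_def sub by auto
  then show ?thesis by blast
qed

text \<open>
  The pairs \<open>(w\<^sub>u, w\<^sub>v)\<close> of both sides have determinant 1, so a linear map of determinant 1 moves the vectors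
  of the inner side such that the two families agree at \<open>u\<close> and \<open>v\<close>. A vector strictly inside is then a
  combination of \<open>w\<^sub>u\<close> and \<open>w\<^sub>v\<close> with positive coefficients, so determinants across the cut are positive.
\<close>

lemma realizes_glue:
  assumes "finite V" "dissection V D" "{u, v} \<in> D" "u < v"
    and in': "realizes (side V u v) (D \<inter> diagonals (side V u v)) p2 q2"
    and out: "realizes (side V v u) (D \<inter> diagonals (side V v u)) p1 q1"
  shows "\<exists>p q. realizes V D p q"
proof -
  let ?I = "side V u v" and ?O = "side V v u"
  have dg: "{u, v} \<in> diagonals V" "{v, u} \<in> diagonals V" using assms by (auto simp: dissection_def insert_commute)
  note uvV = diagonal_endpoints[OF dg(1)]
  have uv: "u \<in> ?I" "v \<in> ?I" "u \<in> ?O" "v \<in> ?O" using side_Un[OF dg(1)] by auto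
  have val: "p u * q v - p v * q u = 1"
    if "realizes (side V x y) (D \<inter> diagonals (side V x y)) p q" "{x, y} = {u, v}" for p q x y
  proof -
    have "{x, y} \<in> D" using assms(3) that(2) by simp
    then obtain W where "W \<in> subpolygons (side V x y) (D \<inter> diagonals (side V x y))"
      "{x, y} \<in> boundary_arcs W"
      by (rule piece_at_cut[OF assms(1,2)])
    then show ?thesis using that assms(4) unfolding realizes_def by simp
  qed
  have val1: "p1 u * q1 v - p1 v * q1 u = 1" using val[OF out] by (simp add: insert_commute)
  have val2: "p2 u * q2 v - p2 v * q2 u = 1" using val[OF in'] by simp
  \<comment> \<open>the coordinates of the inner vector at \<open>y\<close> with respect to the basis at \<open>u\<close>, \<open>v\<close>\<close>
  define \<alpha> where "\<alpha> y = p2 y * q2 v - p2 v * q2 y" for y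
  define \<beta> where "\<beta> y = p2 u * q2 y - p2 y * q2 u" for y
  define p where "p y = (if y \<in> ?I then \<alpha> y * p1 u + \<beta> y * p1 v else p1 y)" for y
  define q where "q y = (if y \<in> ?I then \<alpha> y * q1 u + \<beta> y * q1 v else q1 y)" for y
  have ab: "\<alpha> u = 1" "\<beta> u = 0" "\<alpha> v = 0" "\<beta> v = 1"
    using val2 by (simp_all add: \<alpha>_def \<beta>_def algebra_simps)
  have O: "p y = p1 y \<and> q y = q1 y" if "y \<in> ?O" for y
  proof (cases "y \<in> ?I")
    case True
    then have "y = u \<or> y = v" using that side_Un(2)[OF dg(1)] by blast
    then show ?thesis using ab uv by (auto simp: p_def q_def)
  qed (simp add: p_def q_def)
  have I: "p x * q y - p y * q x = p2 x * q2 y - p2 y * q2 x" if "x \<in> ?I" "y \<in> ?I" for x y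
  proof -
    \<comment> \<open>the Pluecker relation for the vectors at \<open>x\<close>, \<open>y\<close>, \<open>u\<close>, \<open>v\<close>\<close>
    have "p x * q y - p y * q x = (\<alpha> x * \<beta> y - \<alpha> y * \<beta> x) * (p1 u * q1 v - p1 v * q1 u)"
      using that by (simp add: p_def q_def algebra_simps)
    also have "\<dots> = (p2 x * q2 y - p2 y * q2 x) * (p2 u * q2 v - p2 v * q2 u)"
      unfolding val1 by (simp add: \<alpha>_def \<beta>_def algebra_simps)
    finally show ?thesis using val2 by simp
  qed
  have IO: "p x * q y - p y * q x = \<alpha> x * (p1 u * q1 y - p1 y * q1 u) + \<beta> x * (p1 v * q1 y - p1 y * q1 v)"
    if "x \<in> ?I" "y \<in> ?O" for x y
    using that O[of y] by (simp add: p_def q_def algebra_simps)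
  have OI: "p y * q x - p x * q y = \<alpha> x * (p1 y * q1 u - p1 u * q1 y) + \<beta> x * (p1 y * q1 v - p1 v * q1 y)"
    if "x \<in> ?I" "y \<in> ?O" for x y
    using that O[of y] by (simp add: p_def q_def algebra_simps)
  have pos1: "real_of_zsqrt2 (p1 i * q1 j - p1 j * q1 i) > 0" if "i \<in> ?O" "j \<in> ?O" "i < j" for i j
    using out that unfolding realizes_def by blast
  have pos2: "real_of_zsqrt2 (p2 i * q2 j - p2 j * q2 i) > 0" if "i \<in> ?I" "j \<in> ?I" "i < j" for i j
    using in' that unfolding realizes_def by blast
  have ineq: "u < x \<and> x < v" if "x \<in> ?I" "x \<notin> ?O" for x
    using that uv assms(4) by (auto simp: side_def cyclic3_def)
  have oneq: "y \<le> u \<or> v \<le> y" if "y \<in> ?O" for y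
    using that assms(4) by (auto simp: side_def cyclic3_def)
  have pos: "real_of_zsqrt2 (p i * q j - p j * q i) > 0" if ij: "i \<in> V" "j \<in> V" "i < j" for i j
  proof -
    have c: "i \<in> ?I \<or> i \<in> ?O" "j \<in> ?I \<or> j \<in> ?O" using ij side_Un(1)[OF dg(1)] by blast+
    consider "i \<in> ?I" "j \<in> ?I" | "i \<in> ?O" "j \<in> ?O" | "i \<in> ?I" "j \<in> ?O" "i \<notin> ?O" "j \<notin> ?I"
      | "i \<in> ?O" "j \<in> ?I" "j \<notin> ?O" "i \<notin> ?I"
      using c by blast
    then show ?thesis
    proof cases
      case 1 then show ?thesis using I pos2 ij by simp
    next
      case 2 then show ?thesis using O[of i] O[of j] pos1 ij by simp
    next
      case 3
      then have i: "u < i" "i < v" and "v \<le> j" "v \<noteq> j" using ineq oneq[of j] ij uv by fastforce+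
      then have "real_of_zsqrt2 (\<alpha> i) > 0" "real_of_zsqrt2 (\<beta> i) > 0"
        "real_of_zsqrt2 (p1 u * q1 j - p1 j * q1 u) > 0" "real_of_zsqrt2 (p1 v * q1 j - p1 j * q1 v) > 0"
        using pos2 pos1 3 uv assms(4) unfolding \<alpha>_def \<beta>_def by auto
      then show ?thesis unfolding IO[OF 3(1,2)]
        unfolding plus_zsqrt2.rep_eq times_zsqrt2.rep_eq by (intro add_pos_pos mult_pos_pos)
    next
      case 4
      then have j: "u < j" "j < v" and "i \<le> u" "i \<noteq> u" using ineq oneq[of i] ij uv by fastforce+
      then have "real_of_zsqrt2 (\<alpha> j) > 0" "real_of_zsqrt2 (\<beta> j) > 0"
        "real_of_zsqrt2 (p1 i * q1 u - p1 u * q1 i) > 0" "real_of_zsqrt2 (p1 i * q1 v - p1 v * q1 i) > 0"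
        using pos2 pos1 4 uv assms(4) unfolding \<alpha>_def \<beta>_def by auto
      then show ?thesis unfolding OI[OF 4(2,1)]
        unfolding plus_zsqrt2.rep_eq times_zsqrt2.rep_eq by (intro add_pos_pos mult_pos_pos)
    qed
  qed
  have agree: "(W \<in> subpolygons ?I (D \<inter> diagonals ?I) \<and> p i * q j - p j * q i = p2 i * q2 j - p2 j * q2 i)
      \<or> (W \<in> subpolygons ?O (D \<inter> diagonals ?O) \<and> p i * q j - p j * q i = p1 i * q1 j - p1 j * q1 i)"
    if W: "W \<in> subpolygons V D" "i \<in> W" "j \<in> W" for W i j
  proof -
    have "W \<in> subpolygons ?I (D \<inter> diagonals ?I) \<or> W \<in> subpolygons ?O (D \<inter> diagonals ?O)"
      using W subpolygons_split[OF assms(2,1,3)] by blast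
    then show ?thesis
    proof
      assume a: "W \<in> subpolygons ?I (D \<inter> diagonals ?I)"
      then have "i \<in> ?I" "j \<in> ?I" using W by (auto simp: subpolygons_def)
      then show ?thesis using a I[of i j] by simp
    next
      assume a: "W \<in> subpolygons ?O (D \<inter> diagonals ?O)"
      then have "i \<in> ?O" "j \<in> ?O" using W by (auto simp: subpolygons_def)
      then show ?thesis using a O[of i] O[of j] by simp
    qed
  qed
  have bd: "p i * q j - p j * q i = 1"
    if "W \<in> subpolygons V D" "i < j" "{i, j} \<in> boundary_arcs W" for W i j
  proof -
    have "i \<in> W" "j \<in> W" using that(3) unfolding boundary_arcs_iff by blast+
    then show ?thesis using agree[OF that(1), of i j] in' out that unfolding realizes_def by metis
  qed
  have diag: "p i * q j - p j * q i = sqrt2"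
    if "W \<in> subpolygons V D" "card W = 4" "i < j" "{i, j} \<in> diagonals W" for W i j
  proof -
    have "i \<in> W" "j \<in> W" using that(4) diagonal_endpoints by blast+
    then show ?thesis using agree[OF that(1), of i j] in' out that unfolding realizes_def by metis
  qed
  have "realizes V D p q" using pos bd diag unfolding realizes_def by blast
  then show ?thesis by blast
qed

lemma realizes_exists:
  assumes "finite V" "card V \<ge> 3" "dissection V D" "tq_dissection V D"
  shows "\<exists>p q. realizes V D p q"
  using assms
proof (induction V D rule: dissection_induct)
  case (undivided V)
  then have "card V = 3 \<or> card V = 4" using subpolygons_empty by (auto simp: tq_dissection_iff)
  then show ?case using realizes_triangle realizes_quadrilateral by blast
next
  case (split V D u v)
  obtain p1 q1 p2 q2 where
    r: "realizes (side V u v) (D \<inter> diagonals (side V u v)) p1 q1"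
      "realizes (side V v u) (D \<inter> diagonals (side V v u)) p2 q2"
    using split.IH tq_dissection_side[OF split.prems split(1,4)] by blast
  have vu: "{v, u} \<in> D" using split by (simp add: insert_commute)
  have "{u, v} \<in> diagonals V" using split by (auto simp: dissection_def)
  then have "u < v \<or> v < u" using diagonal_endpoints(3) by (meson linorder_neqE_nat)
  then show ?case
    using realizes_glue[OF split(1,3,4) _ r] realizes_glue[OF split(1,3) vu _ r(2,1)] by blast
qed

text \<open>
  Crossing arcs are ordered in one of eight ways, and in each of them the Ptolemy relation is the
  Pluecker relation of the four vectors.
\<close>

lemma frieze_of_realization:
  assumes "realizes V D p q" "finite V" "card V \<ge> 3" "dissection V D"
  shows "dissection_frieze V D (\<lambda>i j. if i \<in> V \<and> j \<in> V then
           (if i < j then p i * q j - p j * q i else p j * q i - p i * q j) else 0)"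
    (is "dissection_frieze V D ?f")
proof -
  have pos: "real_of_zsqrt2 (?f i j) > 0" if "i \<in> V" "j \<in> V" "i \<noteq> j" for i j
    using assms(1) that unfolding realizes_def by auto
  have sym: "?f i j = ?f j i" for i j by auto
  have bd: "?f i j = 1" if "W \<in> subpolygons V D" "{i, j} \<in> boundary_arcs W" for W i j
  proof -
    have "i \<in> W" "j \<in> W" "i \<noteq> j" using that(2) unfolding boundary_arcs_iff by blast+
    moreover have "{j, i} \<in> boundary_arcs W" "W \<subseteq> V" using that by (auto simp: insert_commute subpolygons_def)
    ultimately show ?thesis using that assms(1) unfolding realizes_def by auto
  qed
  have dg: "?f i j = sqrt2" if "W \<in> subpolygons V D" "card W = 4" "{i, j} \<in> diagonals W" for W i j
  proof -
    have "i \<in> W" "j \<in> W" "i \<noteq> j" using diagonal_endpoints[OF that(3)] by auto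
    moreover have "{j, i} \<in> diagonals W" "W \<subseteq> V" using that by (auto simp: insert_commute subpolygons_def)
    ultimately show ?thesis using that assms(1) unfolding realizes_def by auto
  qed
  have zero: "?f i j = 0 \<longleftrightarrow> i = j" if "i \<in> V" "j \<in> V" for i j
  proof
    assume "?f i j = 0"
    then have "real_of_zsqrt2 (?f i j) = 0" by (simp only: zero_zsqrt2.rep_eq)
    then show "i = j" using pos[OF that] by fastforce
  qed simp
  have bdV: "?f i j = 1" if "{i, j} \<in> boundary_arcs V" for i j
    using boundary_arc_in_subpolygon[OF assms(2-4) that] bd by blast
  have pt: "?f i j * ?f k l = ?f i l * ?f j k + ?f i k * ?f j l"
    if "{i, j} \<in> diagonals V" "{k, l} \<in> diagonals V" "crossing {i, j} {k, l}" for i j k l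
  proof -
    have V: "i \<in> V" "j \<in> V" "k \<in> V" "l \<in> V" using diagonal_endpoints that by blast+
    have "cyclic4 i k j l \<or> cyclic4 i l j k"
      using that(3) unfolding crossing_iff cyclic4_iff .
    then have "i < k \<and> k < j \<and> j < l \<or> k < j \<and> j < l \<and> l < i \<or>
     j < l \<and> l < i \<and> i < k \<or> l < i \<and> i < k \<and> k < j \<or> i < l \<and> l < j \<and> j < k \<or> l < j \<and> j < k \<and> k < i \<or>
     j < k \<and> k < i \<and> i < l \<or> k < i \<and> i < l \<and> l < j" unfolding cyclic4_def by argo
    then show ?thesis using V by (elim disjE conjE) (simp_all add: algebra_simps)
  qed
  have "frieze V ?f" unfolding frieze_def using zero sym bdV pt by blast
  then show ?thesis unfolding dissection_frieze_def quadrilaterals_def using bd dg by blast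
qed

lemma dissection_frieze_frieze_of:
  assumes "finite V" "card V \<ge> 3" "tq_dissection V D"
  shows "dissection_frieze V D (frieze_of V D)"
proof -
  have D: "dissection V D" using assms(3) by (simp add: tq_dissection_iff)
  obtain p q where "realizes V D p q" using realizes_exists[OF assms(1,2) D assms(3)] by blast
  then obtain f where f: "dissection_frieze V D f" "\<forall>i j. i \<notin> V \<or> j \<notin> V \<longrightarrow> f i j = 0"
    by (rule that[OF frieze_of_realization[OF _ assms(1,2) D]]) auto
  define P where "P g \<longleftrightarrow> frieze V g \<and> (\<forall>W\<in>subpolygons V D. \<forall>i j. {i, j} \<in> boundary_arcs W \<longrightarrow> g i j = 1) \<and>
      (\<forall>Q\<in>quadrilaterals V D. \<forall>i j. {i, j} \<in> diagonals Q \<longrightarrow> g i j = sqrt2) \<and>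
      (\<forall>i j. i \<notin> V \<or> j \<notin> V \<longrightarrow> g i j = 0)" for g
  have P: "P g \<longleftrightarrow> dissection_frieze V D g \<and> (\<forall>i j. i \<notin> V \<or> j \<notin> V \<longrightarrow> g i j = 0)" for g
    unfolding P_def dissection_frieze_def by argo
  have "frieze_of V D = The P" unfolding frieze_of_def P_def ..
  moreover have "P (The P)"
  proof (rule theI[of P])
    show "P f" using f P by blast
  next
    fix g assume "P g"
    then have g: "dissection_frieze V D g" "\<forall>i j. i \<notin> V \<or> j \<notin> V \<longrightarrow> g i j = 0"
      using P by blast+
    show "g = f"
    proof (intro ext)
      fix i j show "g i j = f i j"
        using dissection_frieze_unique[OF assms(1,2) D assms(3) g(1) f(1)] f(2) g(2)
        by (cases "i \<in> V \<and> j \<in> V") auto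
    qed
  qed
  ultimately show ?thesis using P by metis
qed

lemma realizes_positive:
  assumes "realizes V D p q" "finite V" "card V \<ge> 3" "tq_dissection V D"
    "dissection_frieze V D f" "x \<in> V" "y \<in> V" "x \<noteq> y"
  shows "real_of_zsqrt2 (f x y) > 0"
proof -
  have D: "dissection V D" using assms(4) by (simp add: tq_dissection_iff)
  have "f x y = (if x < y then p x * q y - p y * q x else p y * q x - p x * q y)"
    using dissection_frieze_unique[OF assms(2,3) D assms(4,5) frieze_of_realization[OF assms(1-3) D]]
      assms(6,7) by simp
  then show ?thesis using assms(1,6-8) unfolding realizes_def by auto
qed

lemma dissection_frieze_positive:
  assumes "finite V" "card V \<ge> 3" "tq_dissection V D"
    "dissection_frieze V D f" "x \<in> V" "y \<in> V" "x \<noteq> y"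
  shows "real_of_zsqrt2 (f x y) > 0"
  using realizes_exists[OF assms(1,2) _ assms(3)] realizes_positive assms
  by (metis tq_dissection_iff)

section \<open>Values on triangulated and on quadrangulated polygons\<close>

lemma triangulated_frieze_integer:
  assumes "finite V" "card V \<ge> 3" "dissection V D" "\<forall>W\<in>subpolygons V D. card W = 3"
    "dissection_frieze V D f"
  shows "\<forall>i\<in>V. \<forall>j\<in>V. f i j \<in> range of_int"
  using assms
proof (induction V D rule: dissection_induct)
  case (undivided V)
  then have "card V = 3" using subpolygons_empty by auto
  show ?case
  proof (intro ballI)
    fix i j assume ij: "i \<in> V" "j \<in> V"
    have "f i j = of_int 0 \<or> f i j = of_int 1"
      using arc_disj[OF ij] triangle_no_diagonals[OF \<open>card V = 3\<close>] ij
        dissection_frieze_D(1,3)[OF undivided.prems(2)] by (cases "i = j") auto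
    then show "f i j \<in> range of_int" by blast
  qed
next
  case (split V D u v)
  have vu: "{v, u} \<in> D" using split by (simp add: insert_commute)
  have dg: "{u, v} \<in> diagonals V" using split by (auto simp: dissection_def)
  note sp = subpolygons_split[OF split(3,1,4)]
  have 1: "\<forall>i\<in>side V u v. \<forall>j\<in>side V u v. f i j \<in> range of_int"
    using split.IH(1) split.prems sp dissection_frieze_side[OF split.prems(2) split(1,3,4)] by blast
  have 2: "\<forall>i\<in>side V v u. \<forall>j\<in>side V v u. f i j \<in> range of_int"
    using split.IH(2) split.prems sp dissection_frieze_side[OF split.prems(2) split(1,3) vu] by blast
  have uv: "u \<in> side V u v" "v \<in> side V u v" "u \<in> side V v u" "v \<in> side V v u"
    using side_Un[OF dg] by auto
  have 3: "f x y \<in> range of_int" if xy: "x \<in> side V u v" "y \<in> side V v u" for x y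
  proof -
    obtain a b c d where "f x u = of_int a" "f x v = of_int b" "f y u = of_int c" "f y v = of_int d"
      using bspec[OF bspec[OF 1 xy(1)] uv(1)] bspec[OF bspec[OF 1 xy(1)] uv(2)]
        bspec[OF bspec[OF 2 xy(2)] uv(3)] bspec[OF bspec[OF 2 xy(2)] uv(4)] by blast
    then have "f x y = of_int (a * d + b * c)"
      using dissection_frieze_across[OF split.prems(2) split(1,3,4) xy] by simp
    then show ?thesis by blast
  qed
  show ?case
  proof (intro ballI)
    fix i j assume ij: "i \<in> V" "j \<in> V"
    then have "i \<in> side V u v \<or> i \<in> side V v u" "j \<in> side V u v \<or> j \<in> side V v u"
      using side_Un(1)[OF dg] by blast+
    moreover have "f i j = f j i" using dissection_frieze_D(2)[OF split.prems(2) ij] .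
    ultimately show "f i j \<in> range of_int" using 1 2 3[of i j] 3[of j i] by metis
  qed
qed

lemma triangulated_frieze_positive_integer:
  assumes "finite V" "card V \<ge> 3" "dissection V D" "\<forall>W\<in>subpolygons V D. card W = 3"
    "dissection_frieze V D f" "i \<in> V" "j \<in> V" "i \<noteq> j"
  obtains k where "f i j = of_int k" "k > 0"
proof -
  obtain k where k: "f i j = of_int k"
    using triangulated_frieze_integer[OF assms(1-5)] assms(6,7) by blast
  have "tq_dissection V D" using assms(3,4) by (simp add: tq_dissection_iff)
  then have "real_of_zsqrt2 (f i j) > 0" using dissection_frieze_positive assms by blast
  then show ?thesis using that k by simp
qed

text \<open>
  For a quadrangulated polygon the colour is the parity of the position along the boundary; here it
  is characterized by its effect on the values of \<open>f\<close>, which is what glues along a cut.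
\<close>

definition colours :: "(nat \<Rightarrow> nat \<Rightarrow> zsqrt2) \<Rightarrow> nat set \<Rightarrow> (nat \<Rightarrow> bool) \<Rightarrow> bool" where
  "colours f V c \<longleftrightarrow> (\<forall>i\<in>V. \<forall>j\<in>V.
     if c i = c j then \<exists>k. f i j = of_int k * sqrt2 else \<exists>k. f i j = of_int k)"

lemma colours_same: "colours f V c \<Longrightarrow> i \<in> V \<Longrightarrow> j \<in> V \<Longrightarrow> c i = c j \<Longrightarrow> \<exists>k. f i j = of_int k * sqrt2"
  unfolding colours_def by meson

lemma colours_differ: "colours f V c \<Longrightarrow> i \<in> V \<Longrightarrow> j \<in> V \<Longrightarrow> c i \<noteq> c j \<Longrightarrow> \<exists>k. f i j = of_int k"
  unfolding colours_def by meson

lemma colours_unit: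
  assumes "colours f V c" "i \<in> V" "j \<in> V" "f i j dvd 1"
  shows "c i \<noteq> c j"
proof
  assume "c i = c j"
  then obtain k where "f i j = of_int k * sqrt2" using colours_same assms by blast
  then show False using assms(4) not_unit_multiple_of_sqrt2 by metis
qed

text \<open>
  Colourings of the two sides of a cut glue: as \<open>f u v = 1\<close> is a unit, either of them separates \<open>u\<close> from \<open>v\<close>,
  and after exchanging the colours on one side, if necessary, they agree on both points. Since
  \<open>\<surd>2 \<cdot> \<surd>2\<close> is an integer, the property then extends across the cut.
\<close>

lemma quadrangulated_frieze_colours:
  assumes "finite V" "card V \<ge> 3" "dissection V D" "\<forall>W\<in>subpolygons V D. card W = 4"
    "dissection_frieze V D f"
  shows "\<exists>c. colours f V c"
  using assms
proof (induction V D rule: dissection_induct)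
  case (undivided V)
  have W: "V \<in> subpolygons V {}" using subpolygons_empty undivided by blast
  then have V4: "card V = 4" using undivided by blast
  then obtain a b c d where V: "V = {a, b, c, d}" "a < b" "b < c" "c < d" by (rule four_vertices)
  have cyc: "cyclic4 a b c d" using V by (simp add: cyclic4_def)
  note F = dissection_frieze_D[OF undivided.prems(2)]
  have val1: "f i j = 1" if "{i, j} \<in> {{a, b}, {b, c}, {c, d}, {d, a}}" for i j
    using that quad_arcs(1)[OF cyc] V(1) F(1) by simp
  have val2: "f i j = sqrt2" if "{i, j} \<in> {{a, c}, {b, d}}" for i j
    using that quad_arcs(2)[OF cyc] V(1) F(7)[OF W V4] by simp
  define col where "col x \<longleftrightarrow> x = a \<or> x = c" for x
  have "if col i = col j then \<exists>k. f i j = of_int k * sqrt2 else \<exists>k. f i j = of_int k"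
    if ij: "i \<in> V" "j \<in> V" for i j
  proof -
    consider "i = j" | "i \<noteq> j" "col i = col j" | "col i \<noteq> col j" by blast
    then show ?thesis
    proof cases
      case 1
      then have "f i j = of_int 0 * sqrt2" using F(3) ij by simp
      then show ?thesis using 1 by metis
    next
      case 2
      then have "{i, j} \<in> {{a, c}, {b, d}}" using ij V unfolding V(1) col_def by auto
      then have "f i j = of_int 1 * sqrt2" using val2 by simp
      then show ?thesis using 2 by metis
    next
      case 3
      then have "{i, j} \<in> {{a, b}, {b, c}, {c, d}, {d, a}}" using ij V unfolding V(1) col_def by auto
      then have "f i j = of_int 1" using val1 by simp
      then show ?thesis using 3 by metis
    qed
  qed
  then show ?case unfolding colours_def by blast
next
  case (split V D u v)
  have vu: "{v, u} \<in> D" using split by (simp add: insert_commute)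
  have dg: "{u, v} \<in> diagonals V" using split by (auto simp: dissection_def)
  note sp = subpolygons_split[OF split(3,1,4)]
  obtain c1 where c1: "colours f (side V u v) c1"
    using split.IH(1) split.prems sp dissection_frieze_side[OF split.prems(2) split(1,3,4)] by blast
  obtain c2 where c2: "colours f (side V v u) c2"
    using split.IH(2) split.prems sp dissection_frieze_side[OF split.prems(2) split(1,3) vu] by blast
  have uv: "u \<in> side V u v" "v \<in> side V u v" "u \<in> side V v u" "v \<in> side V v u"
    using side_Un[OF dg] by auto
  have "f u v dvd 1" using dissection_frieze_arc[OF split.prems(2) split(1,3,4)] by simp
  then have cuv: "c1 u \<noteq> c1 v" "c2 u \<noteq> c2 v"
    using colours_unit[OF c1 uv(1,2)] colours_unit[OF c2 uv(3,4)] by auto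
  define c where "c x = (if x \<in> side V u v then c1 x else c2 x = (c2 u = c1 u))" for x
  have cO: "c x = (c2 x = (c2 u = c1 u))" if "x \<in> side V v u" for x
  proof (cases "x \<in> side V u v")
    case True
    then have "x = u \<or> x = v" using that side_Un(2)[OF dg] by blast
    then show ?thesis using True cuv by (auto simp: c_def)
  qed (simp add: c_def)
  have 1: "colours f (side V u v) c" using c1 unfolding colours_def c_def by simp
  have 2: "colours f (side V v u) c"
  proof -
    have "(c i = c j) = (c2 i = c2 j)" if "i \<in> side V v u" "j \<in> side V v u" for i j
      using cO that by auto
    then show ?thesis using c2 unfolding colours_def by simp
  qed
  have cuv': "c u \<noteq> c v" using uv cuv by (simp add: c_def)
  have 3: "if c x = c y then \<exists>k. f x y = of_int k * sqrt2 else \<exists>k. f x y = of_int k"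
    if xy: "x \<in> side V u v" "y \<in> side V v u" for x y
  proof -
    have eq: "f x y = f x u * f y v + f x v * f y u"
      using dissection_frieze_across[OF split.prems(2) split(1,3,4) xy] .
    note same1 = colours_same[OF 1 xy(1)] and same2 = colours_same[OF 2 xy(2)]
      and diff1 = colours_differ[OF 1 xy(1)] and diff2 = colours_differ[OF 2 xy(2)]
    consider "c x = c u" "c y = c u" | "c x = c u" "c y = c v" | "c x = c v" "c y = c u" | "c x = c v" "c y = c v"
      using cuv' by blast
    then show ?thesis
    proof cases
      case 1
      then obtain k l m n where "f x u = of_int k * sqrt2" "f y v = of_int l" "f x v = of_int m" "f y u = of_int n * sqrt2"
        using same1[OF uv(1)] same2[OF uv(3)] diff1[OF uv(2)] diff2[OF uv(4)] cuv' by metis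
      then have "f x y = of_int (k * l + m * n) * sqrt2" using eq by (simp add: algebra_simps)
      then show ?thesis using 1 by metis
    next
      case 2
      then obtain k l m n where "f x u = of_int k * sqrt2" "f y v = of_int l * sqrt2" "f x v = of_int m" "f y u = of_int n"
        using same1[OF uv(1)] same2[OF uv(4)] diff1[OF uv(2)] diff2[OF uv(3)] cuv' by metis
      then have "f x y = of_int (k * l) * (sqrt2 * sqrt2) + of_int (m * n)" using eq by (simp add: algebra_simps)
      then have "f x y = of_int (2 * k * l + m * n)" by (simp add: sqrt2_sqrt2)
      then show ?thesis using 2 cuv' by metis
    next
      case 3
      then obtain k l m n where "f x u = of_int k" "f y v = of_int l" "f x v = of_int m * sqrt2" "f y u = of_int n * sqrt2"
        using same1[OF uv(2)] same2[OF uv(3)] diff1[OF uv(1)] diff2[OF uv(4)] cuv' by metis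
      then have "f x y = of_int (k * l) + of_int (m * n) * (sqrt2 * sqrt2)" using eq by (simp add: algebra_simps)
      then have "f x y = of_int (k * l + 2 * m * n)" by (simp add: sqrt2_sqrt2)
      then show ?thesis using 3 cuv' by metis
    next
      case 4
      then obtain k l m n where "f x u = of_int k" "f y v = of_int l * sqrt2" "f x v = of_int m * sqrt2" "f y u = of_int n"
        using same1[OF uv(2)] same2[OF uv(4)] diff1[OF uv(1)] diff2[OF uv(3)] cuv' by metis
      then have "f x y = of_int (k * l + m * n) * sqrt2" using eq by (simp add: algebra_simps)
      then show ?thesis using 4 by metis
    qed
  qed
  have "if c i = c j then \<exists>k. f i j = of_int k * sqrt2 else \<exists>k. f i j = of_int k"
    if ij: "i \<in> V" "j \<in> V" for i j
  proof -
    have "i \<in> side V u v \<or> i \<in> side V v u" "j \<in> side V u v \<or> j \<in> side V v u"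
      using ij side_Un(1)[OF dg] by blast+
    then consider (uu) "i \<in> side V u v" "j \<in> side V u v" | (vv) "i \<in> side V v u" "j \<in> side V v u"
      | (uv) "i \<in> side V u v" "j \<in> side V v u" | (vu) "j \<in> side V u v" "i \<in> side V v u" by blast
    then show ?thesis
    proof cases
      case uu then show ?thesis using \<open>colours f (side V u v) c\<close> unfolding colours_def by blast
    next
      case vv then show ?thesis using \<open>colours f (side V v u) c\<close> unfolding colours_def by blast
    next
      case uv then show ?thesis using 3[of i j] by blast
    next
      case vu then show ?thesis using 3[OF vu] dissection_frieze_D(2)[OF split.prems(2) ij] by (simp only: eq_commute[of "c j"])
    qed
  qed
  then show ?case unfolding colours_def by blast
qed

text \<open>
  Two of the three vertices have the same colour, and the value between them is a multiple of \<open>\<surd>2\<close>.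
\<close>

lemma no_unit_triangle_in_quadrangulation:
  assumes "finite V" "card V \<ge> 3" "dissection V D" "\<forall>W\<in>subpolygons V D. card W = 4"
    "dissection_frieze V D f" "x \<in> V" "y \<in> V" "z \<in> V" "f x y dvd 1" "f y z dvd 1" "f x z dvd 1"
  shows False
proof -
  obtain c where "colours f V c" using quadrangulated_frieze_colours[OF assms(1-5)] by blast
  then show False using colours_unit assms(6-) by metis
qed

section \<open>Rows of quadrilaterals\<close>

definition pieces_at :: "nat set \<Rightarrow> nat set set \<Rightarrow> nat \<Rightarrow> nat" where
  "pieces_at V D x = card {W \<in> subpolygons V D. x \<in> W}"

lemma finite_subpolygons: "finite V \<Longrightarrow> finite (subpolygons V D)"
  by (rule finite_subset[of _ "Pow V"]) (auto simp: subpolygons_def)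

lemma pieces_at_split:
  assumes "finite V" "dissection V D" "{u, v} \<in> D"
  shows "pieces_at V D x = pieces_at (side V u v) (D \<inter> diagonals (side V u v)) x
                         + pieces_at (side V v u) (D \<inter> diagonals (side V v u)) x"
proof -
  let ?A = "subpolygons (side V u v) (D \<inter> diagonals (side V u v))"
  let ?B = "subpolygons (side V v u) (D \<inter> diagonals (side V v u))"
  have dg: "{u, v} \<in> diagonals V" using assms by (auto simp: dissection_def)
  have "{W \<in> subpolygons V D. x \<in> W} = {W \<in> ?A. x \<in> W} \<union> {W \<in> ?B. x \<in> W}"
    using subpolygons_split[OF assms(2,1,3)] by blast
  moreover have "{W \<in> ?A. x \<in> W} \<inter> {W \<in> ?B. x \<in> W} = {}"
    using subpolygons_sides_disjoint[OF dg] by blast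
  ultimately show ?thesis
    using card_Un_disjoint[of "{W \<in> ?A. x \<in> W}" "{W \<in> ?B. x \<in> W}"]
      finite_subpolygons[OF finite_subset[OF side_subset assms(1)]] unfolding pieces_at_def by simp
qed

lemma pieces_at_pos:
  assumes "finite V" "card V \<ge> 3" "dissection V D" "x \<in> V"
  shows "pieces_at V D x \<ge> 1"
proof -
  obtain w where w: "w \<in> V" "w \<noteq> x" "\<And>k. k \<in> V \<Longrightarrow> \<not> cyclic3 x k w"
    using next_vertex[of V x] assms by auto
  then have "{x, w} \<in> boundary_arcs V" using assms(4) by (intro boundary_arcs_I) auto
  then obtain W where "W \<in> subpolygons V D" "{x, w} \<in> boundary_arcs W"
    using boundary_arc_in_subpolygon[OF assms(1-3)] by blast
  then have "W \<in> {W \<in> subpolygons V D. x \<in> W}" unfolding boundary_arcs_iff by blast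
  then show ?thesis using finite_subpolygons[OF assms(1), of D] card_gt_0_iff[of "{W \<in> subpolygons V D. x \<in> W}"]
    unfolding pieces_at_def by (auto simp: Suc_le_eq)
qed

lemma pieces_at_outside: "x \<notin> V \<Longrightarrow> pieces_at V D x = 0"
  unfolding pieces_at_def subpolygons_def by (auto simp: card_eq_0_iff)

lemma subpolygons_whole:
  assumes "finite V" "V \<in> subpolygons V D"
  shows "subpolygons V D = {V}"
proof -
  have "W = V" if "W \<in> subpolygons V D" for W
    using subpolygons_eq_if_subset[OF assms(1) that assms(2)] that by (simp add: subpolygons_def)
  then show ?thesis using assms(2) by blast
qed

lemma pieces_at_whole:
  assumes "finite V" "V \<in> subpolygons V D" "x \<in> V"
  shows "pieces_at V D x = 1"
proof -
  have "{W \<in> subpolygons V D. x \<in> W} = {V}" using subpolygons_whole[OF assms(1,2)] assms(3) by auto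
  then show ?thesis unfolding pieces_at_def by simp
qed

text \<open>
  For a quadrangulated polygon this says that the quadrilaterals form a straight row whose first one
  has \<open>{u, v}\<close> as its end. It is phrased by numbers of pieces because towers are.
\<close>

definition row :: "nat set \<Rightarrow> nat set set \<Rightarrow> nat \<Rightarrow> nat \<Rightarrow> bool" where
  "row V D u v \<longleftrightarrow> pieces_at V D u \<le> 1 \<and> pieces_at V D v \<le> 1 \<and> (\<forall>y\<in>V. pieces_at V D y \<le> 2)"

lemma orient_arc:
  assumes "dissection V D" "finite V" "{a, b} \<in> D" "Q \<in> subpolygons V D"
  obtains a' b' where "{a', b'} = {a, b}" "Q \<subseteq> side V b' a'"
  using subpolygon_subset_side[OF assms(1,2,3,4)] that[of a b] that[of b a] by blast

lemma quad_piece_at_side: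
  assumes "dissection_frieze V D f" "Q \<in> subpolygons V D" "card Q = 4" "{a, b} \<in> boundary_arcs Q"
  obtains w w' where "Q = {a, w, w', b}" "distinct [a, w, w', b]"
    "boundary_arcs Q = {{a, w}, {w, w'}, {w', b}, {a, b}}"
    "f w a = 1" "f w b = sqrt2" "f w' a = sqrt2" "f w' b = 1" "f a b = 1" "f b a = 1" "f w w' = 1"
    "f a w' = sqrt2" "f b w = sqrt2" "f a w = 1" "f b w' = 1"
proof -
  obtain w w' where Q: "Q = {a, w, w', b}" "cyclic4 a w w' b \<or> cyclic4 b w' w a"
    using quad_at_side[OF assms(3,4)] by blast
  have ns: "distinct [a, w, w', b]" using Q(2) by (auto simp: cyclic4_def)
  have arcs: "boundary_arcs Q = {{a, w}, {w, w'}, {w', b}, {a, b}} \<and> diagonals Q = {{a, w'}, {w, b}}"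
    using Q(2)
  proof
    assume "cyclic4 a w w' b"
    then show ?thesis using quad_arcs[of a w w' b] Q(1) by (simp add: insert_commute)
  next
    assume c: "cyclic4 b w' w a"
    have "Q = {b, w', w, a}" using Q(1) by auto
    then show ?thesis using quad_arcs[OF c] by (simp add: insert_commute)
  qed
  note F = dissection_frieze_D(6)[OF assms(1,2)] dissection_frieze_D(7)[OF assms(1,2,3)]
  show ?thesis
    by (rule that[OF Q(1) ns conjunct1[OF arcs]]) (rule F; simp add: arcs insert_commute)+
qed

text \<open>
  Both conditions are compared while the quadrilateral \<open>u, p, q, v\<close> at \<open>{u, v}\<close> is peeled off. If it has a
  neighbour at a lateral side, both fail. Otherwise it is everything, or it has one
  neighbour beyond \<open>{p, q}\<close>, and both conditions pass to the corresponding ones for the rest and \<open>{p, q}\<close>.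
\<close>

lemma row_iff_units:
  assumes "finite V" "card V \<ge> 3" "dissection V D" "\<forall>W\<in>subpolygons V D. card W = 4"
    "dissection_frieze V D f" "{u, v} \<in> boundary_arcs V"
  shows "row V D u v \<longleftrightarrow> (\<forall>y\<in>V. f y u + f y v dvd 1)"
  using assms
proof (induction "card V" arbitrary: V D u v rule: less_induct)
  case less
  note fin = less.prems(1) and c3 = less.prems(2) and D = less.prems(3) and quads = less.prems(4)
    and F = less.prems(5) and bd = less.prems(6)
  obtain Q where Q: "Q \<in> subpolygons V D" "{u, v} \<in> boundary_arcs Q"
    using boundary_arc_in_subpolygon[OF fin c3 D bd] by blast
  then have Q4: "card Q = 4" using quads by blast
  obtain p q where pq: "Q = {u, p, q, v}" "distinct [u, p, q, v]"
    "boundary_arcs Q = {{u, p}, {p, q}, {q, v}, {u, v}}"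
    "f p u = 1" "f p v = sqrt2" "f q u = sqrt2" "f q v = 1" "f u v = 1" "f v u = 1" "f p q = 1"
    "f u q = sqrt2" "f v p = sqrt2" "f u p = 1" "f v q = 1"
    using quad_piece_at_side[OF F Q(1) Q4 Q(2)] .
  have QV: "Q \<subseteq> V" "boundary_arcs Q \<subseteq> D \<union> boundary_arcs V" using Q by (auto simp: subpolygons_def)
  then have inV: "u \<in> V" "p \<in> V" "q \<in> V" "v \<in> V" using pq(1) by auto
  have z: "f u u = 0" "f v v = 0" using dissection_frieze_D(3)[OF F] inV by auto
  \<comment> \<open>a neighbour at the lateral side \<open>{a, b}\<close>, with \<open>d\<close> the other end point of \<open>{u, v}\<close>\<close>
  have branch: "\<not> (pieces_at V D a \<le> 1) \<and> \<not> (\<forall>y\<in>V. f y a + f y d dvd 1)"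
    if ab: "{a, b} \<in> D" and abd: "f d a = 1" "f d b = sqrt2" "d \<in> Q" for a b d
  proof -
    have dg: "{a, b} \<in> diagonals V" using D ab by (auto simp: dissection_def)
    have "a \<in> side V a b" "a \<in> side V b a" using diagonal_endpoints[OF dg] by (auto simp: side_def)
    moreover have dg': "{b, a} \<in> diagonals V" using dg by (simp add: insert_commute)
    ultimately have "pieces_at (side V a b) (D \<inter> diagonals (side V a b)) a \<ge> 1"
      "pieces_at (side V b a) (D \<inter> diagonals (side V b a)) a \<ge> 1"
      using pieces_at_pos[OF finite_subset[OF side_subset fin]] card_side(2)[OF dg fin] card_side(2)[OF dg' fin]
        dissection_restrict[OF D] by blast+
    then have 1: "pieces_at V D a \<ge> 2" using pieces_at_split[OF fin D ab, of a] by simp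
    obtain a' b' where ab': "{a', b'} = {a, b}" "Q \<subseteq> side V b' a'" using orient_arc[OF D fin ab Q(1)] .
    have dg2: "{a', b'} \<in> diagonals V" "{a', b'} \<in> D" using ab' dg ab by auto
    obtain R where R: "R \<in> subpolygons (side V a' b') (D \<inter> diagonals (side V a' b'))"
      "{a, b} \<in> boundary_arcs R"
      using piece_at_cut[OF fin D dg2(2)] unfolding ab'(1) .
    then have RV: "R \<in> subpolygons V D" "R \<subseteq> side V a' b'"
      using subpolygons_split[OF D fin dg2(2)] by (auto simp: subpolygons_def)
    then have "card R = 4" using quads by blast
    then obtain w w' where w: "R = {a, w, w', b}" "f w a = 1" "f w b = sqrt2"
      using quad_piece_at_side[OF F RV(1) _ R(2)] by metis
    have wV: "w \<in> side V a' b'" using RV(2) w(1) by auto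
    have "f w d = f w a' * f d b' + f w b' * f d a'"
      using dissection_frieze_across[OF F fin D dg2(2) wV, of d] abd ab'(2) by blast
    \<comment> \<open>the vertex \<open>w\<close> next to \<open>a\<close> in the neighbour spoils the units: \<open>f w a + f w d = 1 + 2\<surd>2\<close>\<close>
    then have "f w d = 2 * sqrt2" using ab'(1) w abd by (auto simp: doubleton_eq_iff)
    then have "\<not> f w a + f w d dvd 1" using not_unit_1_2sqrt2 w by simp
    moreover have "w \<in> V" using wV side_subset by blast
    ultimately show ?thesis using 1 by auto
  qed
  show ?case
  proof (cases "{u, p} \<in> D \<or> {v, q} \<in> D")
    case True
    then have "(\<not> pieces_at V D u \<le> 1 \<or> \<not> pieces_at V D v \<le> 1) \<and> \<not> (\<forall>y\<in>V. f y u + f y v dvd 1)"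
      using branch[of u p v] branch[of v q u] pq(1) pq(4-14) by (simp add: add.commute) blast
    then show ?thesis unfolding row_def by blast
  next
    case False
    then have bds: "{u, p} \<in> boundary_arcs V" "{q, v} \<in> boundary_arcs V"
      using QV(2) pq(3) by (auto simp: insert_commute)
    show ?thesis
    proof (cases "{p, q} \<in> D")
      case False
      then have "boundary_arcs Q \<subseteq> boundary_arcs V" using bds bd QV(2) pq(3) by auto
      then have QV': "Q = V" using boundary_arcs_subset_imp_eq[OF fin QV(1)] Q4 by simp
      have "pieces_at V D y = 1" if "y \<in> V" for y
        using pieces_at_whole[OF fin _ that, of D] Q(1) QV' by simp
      then have "row V D u v" using inV unfolding row_def by simp
      moreover have "f y u + f y v dvd 1" if "y \<in> V" for y
      proof -
        have "y \<in> {u, p, q, v}" using that QV' pq(1) by simp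
        moreover have "sqrt2 + 1 dvd 1" using unit_1_sqrt2 by (simp add: add.commute)
        ultimately show ?thesis using pq(4-9) unit_1_sqrt2 z by (elim insertE emptyE) simp_all
      qed
      ultimately show ?thesis by blast
    next
      case True
      obtain a b where ab: "{a, b} = {p, q}" "Q \<subseteq> side V b a" using orient_arc[OF D fin True Q(1)] .
      let ?S = "side V a b" and ?N = "side V b a"
      have dg: "{a, b} \<in> diagonals V" "{b, a} \<in> diagonals V" "{a, b} \<in> D"
        using ab True D by (auto simp: dissection_def insert_commute)
      have finS: "finite ?S" "finite ?N" using finite_subset[OF side_subset fin] by auto
      have SN: "?S \<union> ?N = V" "?S \<inter> ?N = {p, q}" using side_Un[OF dg(1)] ab(1) by auto
      note sp = subpolygons_split[OF D fin dg(3)]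
      have QN: "Q \<in> subpolygons ?N (D \<inter> diagonals ?N)"
        using subpolygons_restrict[OF Q(1) ab(2) side_subset] .
      have "{p, q} \<in> boundary_arcs ?N" using boundary_arcs_side[OF dg(2), of p q] ab(1) by (simp add: insert_commute)
      moreover have "{u, p} \<in> boundary_arcs ?N" "{q, v} \<in> boundary_arcs ?N" "{u, v} \<in> boundary_arcs ?N"
        using boundary_arcs_antimono[OF side_subset, of _ V b a] bds bd ab(2) pq(1) by auto
      ultimately have "boundary_arcs Q \<subseteq> boundary_arcs ?N" using pq(3) by simp
      then have QeqN: "Q = ?N" using boundary_arcs_subset_imp_eq[OF finS(2) ab(2)] Q4 by simp
      have nN: "pieces_at ?N (D \<inter> diagonals ?N) y = (if y \<in> Q then 1 else 0)" for y
        using pieces_at_whole[OF finS(2), of _ y] QN QeqN pieces_at_outside[of y ?N] by auto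
      have nV: "pieces_at V D y = pieces_at ?S (D \<inter> diagonals ?S) y + (if y \<in> Q then 1 else 0)" for y
        using pieces_at_split[OF fin D dg(3), of y] nN by simp
      have uvS: "u \<notin> ?S" "v \<notin> ?S" "p \<in> ?S" "q \<in> ?S" using SN(2) QeqN pq(1,2) by auto
      have nouv: "pieces_at V D u = 1" "pieces_at V D v = 1"
        using nV pieces_at_outside uvS pq(1) by auto
      have "row V D u v \<longleftrightarrow> (\<forall>y\<in>V. pieces_at V D y \<le> 2)" unfolding row_def using nouv by simp
      also have "\<dots> \<longleftrightarrow> (\<forall>y\<in>?S. pieces_at V D y \<le> 2)"
      proof -
        have "pieces_at V D y \<le> 2" if "y \<in> V" "y \<notin> ?S" for y
          using nV[of y] pieces_at_outside[OF that(2)] by simp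
        then show ?thesis using side_subset by blast
      qed
      also have "\<dots> \<longleftrightarrow> row ?S (D \<inter> diagonals ?S) p q"
      proof -
        have nS: "pieces_at V D y = pieces_at ?S (D \<inter> diagonals ?S) y + (if y = p \<or> y = q then 1 else 0)"
          if "y \<in> ?S" for y
        proof -
          have "y \<in> Q \<longleftrightarrow> y = p \<or> y = q" using SN(2) QeqN that by blast
          then show ?thesis using nV[of y] by simp
        qed
        show ?thesis
        proof
          assume le: "\<forall>y\<in>?S. pieces_at V D y \<le> 2"
          have "pieces_at ?S (D \<inter> diagonals ?S) y \<le> 2" if "y \<in> ?S" for y
            using bspec[OF le that] nS[OF that] by simp
          then show "row ?S (D \<inter> diagonals ?S) p q"
            using bspec[OF le uvS(3)] bspec[OF le uvS(4)] nS[OF uvS(3)] nS[OF uvS(4)]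
            unfolding row_def by simp
        next
          assume r: "row ?S (D \<inter> diagonals ?S) p q"
          show "\<forall>y\<in>?S. pieces_at V D y \<le> 2"
          proof
            fix y assume "y \<in> ?S"
            then show "pieces_at V D y \<le> 2" using r nS[of y] unfolding row_def by auto
          qed
        qed
      qed
      also have "\<dots> \<longleftrightarrow> (\<forall>y\<in>?S. f y p + f y q dvd 1)"
      proof (rule less.hyps)
        show "card ?S < card V" "3 \<le> card ?S" using card_side[OF dg(1) fin] by auto
        show "\<forall>W\<in>subpolygons ?S (D \<inter> diagonals ?S). card W = 4" using quads sp by blast
        show "{p, q} \<in> boundary_arcs ?S" using boundary_arcs_side[OF dg(1), of p q] ab(1) by simp
      qed (use finS dissection_restrict[OF D] dissection_frieze_side[OF F fin D dg(3)] in auto)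
      also have "\<dots> \<longleftrightarrow> (\<forall>y\<in>?S. f y u + f y v dvd 1)"
      proof -
        have "f y u + f y v dvd 1 \<longleftrightarrow> f y p + f y q dvd 1" if y: "y \<in> ?S" for y
        proof -
          have "f y x = f y a * f x b + f y b * f x a" if "x \<in> Q" for x
            using dissection_frieze_across[OF F fin D dg(3) y] that ab(2) by blast
          then have *: "f y x = f y p * f x q + f y q * f x p" if "x \<in> Q" for x
            using ab(1) that by (auto simp: doubleton_eq_iff)
          have "u \<in> Q" "v \<in> Q" using pq(1) by auto
          then have "f y u = f y p * sqrt2 + f y q" "f y v = f y p + f y q * sqrt2"
            using *[of u] *[of v] pq(11-14) by simp_all
          \<comment> \<open>crossing one quadrilateral of the row multiplies by the unit \<open>1 + \<surd>2\<close>\<close>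
          then have "f y u + f y v = (1 + sqrt2) * (f y p + f y q)" by (simp add: algebra_simps)
          then show ?thesis using unit_mult_1_sqrt2 by simp
        qed
        then show ?thesis by blast
      qed
      also have "\<dots> \<longleftrightarrow> (\<forall>y\<in>V. f y u + f y v dvd 1)"
      proof -
        have "f y u + f y v dvd 1" if "y \<in> V" "y \<notin> ?S" for y
        proof -
          have "y = u \<or> y = v" using that SN QeqN pq(1) uvS by blast
          then show ?thesis using pq(8,9) z by auto
        qed
        then show ?thesis using side_subset by blast
      qed
      finally show ?thesis .
    qed
  qed
qed
lemma card_quadrangulated:
  assumes "finite V" "card V \<ge> 3" "dissection V D" "\<forall>W\<in>subpolygons V D. card W = 4"
  shows "card V = 2 * card (subpolygons V D) + 2"
  using assms
proof (induction V D rule: dissection_induct)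
  case (undivided V)
  then show ?case using subpolygons_empty by auto
next
  case (split V D u v)
  note sp = subpolygons_split[OF split(3,1,4)]
  have dg: "{u, v} \<in> diagonals V" using split by (auto simp: dissection_def)
  have "card (subpolygons V D) = card (subpolygons (side V u v) (D \<inter> diagonals (side V u v)))
      + card (subpolygons (side V v u) (D \<inter> diagonals (side V v u)))"
    unfolding sp using finite_subpolygons finite_subset[OF side_subset split(1)] subpolygons_sides_disjoint[OF dg]
    by (intro card_Un_disjoint) auto
  moreover have "card (side V u v) = 2 * card (subpolygons (side V u v) (D \<inter> diagonals (side V u v))) + 2"
    "card (side V v u) = 2 * card (subpolygons (side V v u) (D \<inter> diagonals (side V v u))) + 2"
    using split.IH split.prems sp by blast+
  ultimately show ?case using card_side(1)[OF dg split(1)] by simp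
qed

section \<open>Decomposability into towers\<close>

text \<open>
  The situation in a separated dissection: \<open>side V u v\<close> is quadrangulated and \<open>side V v u\<close> is
  triangulated. They are abbreviated by \<open>VQ\<close> and \<open>VT\<close>, their dissections by \<open>DQ\<close> and \<open>DT\<close>.
\<close>

locale cut_dissection =
  fixes V :: "nat set" and D :: "nat set set" and u v :: nat
  assumes fin: "finite V" and card3: "card V \<ge> 3" and diss: "dissection V D" and uv: "{u, v} \<in> D"
    and quads: "\<forall>W\<in>subpolygons (side V u v) (D \<inter> diagonals (side V u v)). card W = 4"
    and tris: "\<forall>W\<in>subpolygons (side V v u) (D \<inter> diagonals (side V v u)). card W = 3"
begin

abbreviation "VQ \<equiv> side V u v"
abbreviation "VT \<equiv> side V v u"
abbreviation "DQ \<equiv> D \<inter> diagonals VQ"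
abbreviation "DT \<equiv> D \<inter> diagonals VT"

lemma dg: "{u, v} \<in> diagonals V" "{v, u} \<in> diagonals V"
  using uv diss by (auto simp: dissection_def insert_commute)

lemma vu: "{v, u} \<in> D" using uv by (simp add: insert_commute)

lemma ends: "u \<in> V" "v \<in> V" "u \<noteq> v" "u \<in> VQ" "v \<in> VQ" "u \<in> VT" "v \<in> VT"
  using diagonal_endpoints[OF dg(1)] by (auto simp: side_def)

lemma pieces: "subpolygons V D = subpolygons VQ DQ \<union> subpolygons VT DT"
  by (rule subpolygons_split[OF diss fin uv])

lemma finite_sides: "finite VQ" "finite VT"
  using finite_subset[OF side_subset fin] by auto

lemma not_VT: "y \<in> V \<Longrightarrow> y \<notin> VT \<Longrightarrow> cyclic3 u y v"
  using ends cyclic3_total[of u y v] by (auto simp: side_def)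

lemma not_VQ: "y \<in> V \<Longrightarrow> y \<notin> VQ \<Longrightarrow> cyclic3 v y u"
  using ends cyclic3_total[of u y v] by (auto simp: side_def)

lemma in_VQ: "y \<in> V \<Longrightarrow> cyclic3 u y v \<Longrightarrow> y \<in> VQ \<and> y \<notin> VT"
  using cyclic3_asym cyclic3_distinct by (fastforce simp: side_def)

lemma in_VT: "y \<in> V \<Longrightarrow> cyclic3 v y u \<Longrightarrow> y \<in> VT \<and> y \<notin> VQ"
  using cyclic3_asym cyclic3_distinct by (fastforce simp: side_def)

lemma piece_in_VQ: "X \<in> subpolygons V D \<Longrightarrow> X \<subseteq> VQ \<Longrightarrow> card X = 4"
  using quads subpolygons_restrict[OF _ _ side_subset] by blast

text \<open>
  Let \<open>E\<close> be the set of arcs of the decomposition. If an arc of \<open>E\<close> cut off a polygon inside \<open>VQ\<close>, there would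
  be a tower, and with it a triangle, inside \<open>VQ\<close>. So \<open>E\<close> consists of arcs of the triangulated side, and \<open>VQ\<close>
  lies in a single tower. Its vertices are in at most two pieces, one of which is a
  triangle at \<open>u\<close> and at \<open>v\<close>.
\<close>

lemma row_if_decomposable:
  assumes "tower_decomposable V D"
  shows "row VQ DQ u v"
proof -
  obtain E where E: "E \<subseteq> D" "\<And>W. W \<in> subpolygons V E \<Longrightarrow> \<exists>m. tower m W (D \<inter> diagonals W)"
    using assms unfolding tower_decomposable_def by blast
  have dE: "dissection V E" using dissection_mono[OF diss E(1)] .
  have tri: "\<exists>X\<in>subpolygons V D. X \<subseteq> W \<and> card X = 3" if W: "W \<in> subpolygons V E" for W
  proof -
    obtain m where "tower m W (D \<inter> diagonals W)" using E(2)[OF W] by blast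
    then have "card (triangles W (D \<inter> diagonals W)) = 1" by (simp add: tower_def)
    then have "triangles W (D \<inter> diagonals W) \<noteq> {}" by (metis card.empty zero_neq_one)
    then obtain X where X: "X \<in> subpolygons W (D \<inter> diagonals W)" "card X = 3"
      unfolding triangles_def by blast
    then show ?thesis using subpolygons_refine[OF W E(1) X(1)] by (auto simp: subpolygons_def)
  qed
  \<comment> \<open>no arc of \<open>E\<close> cuts off a part of \<open>VQ\<close>\<close>
  have nocut: False if ab: "{a, b} \<in> E" "side V a b \<subseteq> VQ" for a b
  proof -
    obtain W where W: "W \<in> subpolygons (side V a b) (E \<inter> diagonals (side V a b))"
      using piece_at_cut[OF fin dE ab(1)] by blast
    then have "W \<in> subpolygons V E" "W \<subseteq> VQ"
      using subpolygons_split[OF dE fin ab(1)] ab(2) by (auto simp: subpolygons_def)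
    then obtain X where "X \<in> subpolygons V D" "X \<subseteq> VQ" "card X = 3" using tri by blast
    then show False using piece_in_VQ by fastforce
  qed
  have inVT: "a \<in> VT \<and> b \<in> VT \<and> a \<noteq> b" if ab: "{a, b} \<in> E" for a b
  proof -
    have d: "{a, b} \<in> diagonals V" "\<not> crossing {u, v} {a, b}"
      using ab E(1) diss uv unfolding dissection_def by blast+
    have ba: "{b, a} \<in> E" using ab by (simp add: insert_commute)
    consider "{a, b} = {u, v}" | "{a, b} \<in> diagonals VQ" | "{a, b} \<in> diagonals VT"
      using diagonal_partition[OF dg(1) d] by blast
    then show ?thesis
    proof cases
      case 1
      then have "{u, v} \<in> E" using ab by simp
      then show ?thesis using nocut[of u v] by blast
    next
      case 2
      then show ?thesis
        using side_nested[of a V u v b] diagonal_endpoints[OF 2] ends(3) nocut[OF ab] nocut[OF ba] by blast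
    next
      case 3 then show ?thesis using diagonal_endpoints by blast
    qed
  qed
  have "\<exists>W\<in>subpolygons V E. VQ \<subseteq> W"
  proof (rule subpolygon_containing[OF fin card3 dE side_subset], intro allI impI)
    fix a b assume "{a, b} \<in> E"
    then show "VQ \<subseteq> side V a b \<or> VQ \<subseteq> side V b a"
      using inVT side_nested_opposite[of a V v u b] ends(3) by blast
  qed
  then obtain W where W: "W \<in> subpolygons V E" "VQ \<subseteq> W" by blast
  then have WV: "W \<subseteq> V" by (auto simp: subpolygons_def)
  then have finW: "finite W" using fin finite_subset by blast
  let ?DW = "D \<inter> diagonals W"
  obtain m where m: "tower m W ?DW" using E(2)[OF W(1)] by blast
  obtain X where X: "X \<in> subpolygons V D" "X \<subseteq> W" "card X = 3" using tri[OF W(1)] by blast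
  then have "\<not> X \<subseteq> VQ" using piece_in_VQ by fastforce
  then obtain x where "x \<in> W" "x \<notin> VQ" using X(2) by blast
  moreover have "cyclic3 v x u" using not_VQ calculation WV by blast
  moreover obtain k where "k \<in> V" "cyclic3 u k v" using dg(1) unfolding diagonals_iff by blast
  moreover have "k \<in> W" using in_VQ calculation W(2) by blast
  ultimately have dW: "{u, v} \<in> diagonals W"
    using ends W(2) unfolding diagonals_iff by blast
  have dissW: "dissection W ?DW" using dissection_restrict[OF diss] .
  have uvW: "{u, v} \<in> ?DW" using dW uv by blast
  have sW: "side W u v = VQ" using W(2) WV unfolding side_def by blast
  have DW: "?DW \<inter> diagonals VQ = DQ" using diagonals_mono[OF W(2)] by blast
  let ?R = "side W v u"
  have split: "pieces_at W ?DW y = pieces_at VQ DQ y + pieces_at ?R (?DW \<inter> diagonals ?R) y" for y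
    using pieces_at_split[OF finW dissW uvW, of y] unfolding sW DW .
  have le2: "pieces_at W ?DW y \<le> 2" if "y \<in> W" for y
    using m that unfolding tower_def pieces_at_def by blast
  have dWvu: "{v, u} \<in> diagonals W" using dW by (simp add: insert_commute)
  have R: "finite ?R" "card ?R \<ge> 3" "u \<in> ?R" "v \<in> ?R"
    using card_side(2)[OF dWvu finW] finite_subset[OF side_subset finW] diagonal_endpoints[OF dW]
    by (auto simp: side_def)
  then have "pieces_at ?R (?DW \<inter> diagonals ?R) u \<ge> 1" "pieces_at ?R (?DW \<inter> diagonals ?R) v \<ge> 1"
    using pieces_at_pos[OF R(1,2) dissection_restrict[OF dissW]] by blast+
  moreover have "u \<in> W" "v \<in> W" using W(2) ends by blast+
  ultimately have "pieces_at VQ DQ u \<le> 1" "pieces_at VQ DQ v \<le> 1"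
    using split[of u] split[of v] le2[of u] le2[of v] by simp_all
  moreover have "pieces_at VQ DQ y \<le> 2" if "y \<in> VQ" for y
    using split[of y] le2[of y] W(2) that by fastforce
  ultimately show ?thesis unfolding row_def by blast
qed

text \<open>
  The apex \<open>x\<close> of the triangle on the other side of \<open>{u, v}\<close> is the top of the tower and the centre of
  the fan.
\<close>

lemma base_triangle:
  obtains x where "x \<in> V" "cyclic3 v x u" "{u, x, v} \<in> subpolygons VT DT"
    "{u, x} \<in> DT \<union> boundary_arcs VT" "{x, v} \<in> DT \<union> boundary_arcs VT"
    "{u, x} \<in> boundary_arcs {u, x, v}" "{x, v} \<in> boundary_arcs {u, x, v}"
proof -
  obtain X where X: "X \<in> subpolygons VT DT" "{v, u} \<in> boundary_arcs X"
    using piece_at_cut[OF fin diss vu] .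
  then have X3: "card X = 3" using tris by blast
  obtain x where x: "x \<in> X" "x \<noteq> u" "x \<noteq> v" using third_element[of X u v] X3 by auto
  have uX: "u \<in> X" "v \<in> X" using X(2) unfolding boundary_arcs_iff by blast+
  have "finite X" using X3 card_ge_0_finite[of X] by simp
  then have "{u, x, v} = X"
    using x uX X3 ends(3) by (intro card_subset_eq) auto
  moreover have "x \<in> VT" using X(1) x by (auto simp: subpolygons_def)
  moreover have "cyclic3 v x u" using \<open>x \<in> VT\<close> x by (auto simp: side_def)
  moreover have "{u, x} \<in> boundary_arcs X" "{x, v} \<in> boundary_arcs X"
    using arc_disj[OF uX(1) x(1)] arc_disj[OF x(1) uX(2)] x triangle_no_diagonals[OF X3] by auto
  moreover have "boundary_arcs X \<subseteq> DT \<union> boundary_arcs VT" using X(1) by (auto simp: subpolygons_def)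
  ultimately show ?thesis using that[of x] X(1) side_subset[of V v u] by blast
qed

lemma arcs_of_DT_do_not_cut_VQ:
  assumes "{a, b} \<in> DT"
  shows "VQ \<subseteq> side V a b \<or> VQ \<subseteq> side V b a"
proof -
  have "a \<in> VT" "b \<in> VT" "a \<noteq> b" using assms diagonal_endpoints[of a b VT] by auto
  then show ?thesis using side_nested_opposite[of a V v u b] ends(3) by blast
qed

lemma DT_not_uv: "{u, v} \<notin> DT"
  using diagonals_side[OF dg(2), of u v] by (auto simp: insert_commute)

text \<open>
  The quadrangulated side and the triangle at \<open>{u, v}\<close> are each on one side of the arc, and on the same one,
  as they share \<open>u\<close> and \<open>v\<close>.
\<close>

lemma arcs_of_DT_do_not_cut_tower:
  assumes "{a, b} \<in> DT" "{u, x, v} \<in> subpolygons VT DT"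
  shows "insert x VQ \<subseteq> side V a b \<or> insert x VQ \<subseteq> side V b a"
proof -
  have X: "{u, x, v} \<subseteq> side V a b \<or> {u, x, v} \<subseteq> side V b a"
    using subpolygon_subset_side[OF diss fin _ , of a b "{u, x, v}"] assms pieces by blast
  have d: "{a, b} \<in> diagonals V" using assms diss by (auto simp: dissection_def)
  have "\<not> ({u, v} \<subseteq> {a, b})"
    using DT_not_uv assms(1) ends(3) by (auto simp: insert_commute)
  then show ?thesis
    using X arcs_of_DT_do_not_cut_VQ[OF assms(1)] side_Un(2)[OF d] ends(4,5) by blast
qed

text \<open>
  Whatever remains of the triangulated side lies behind one of the two other sides of the triangle at
  \<open>{u, v}\<close>, which therefore is an arc of \<open>D\<close> and not an edge of the polygon.
\<close>

lemma apex_cuts: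
  assumes x: "x \<in> V" "cyclic3 v x u" "{u, x} \<in> DT \<union> boundary_arcs VT" "{x, v} \<in> DT \<union> boundary_arcs VT"
    and z: "z \<in> VT" "z \<notin> {u, x, v}"
  shows "cyclic3 x z u \<and> {x, u} \<in> DT \<or> cyclic3 v z x \<and> {v, x} \<in> DT"
proof -
  have zc: "cyclic3 v z u" using z by (auto simp: side_def)
  have "z \<noteq> x" using z by blast
  then consider "cyclic3 x z u" "cyclic3 u v x" | "cyclic3 v z x" "cyclic3 x u v"
    using zc x(2) unfolding cyclic3_def by (smt (verit))
  then show ?thesis
  proof cases
    case 1
    then have "{x, u} \<notin> boundary_arcs VT" using not_boundary_arcs_I[OF z(1) _ ends(7)] by blast
    then show ?thesis using 1 x(3) by (auto simp: insert_commute)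
  next
    case 2
    then have "{v, x} \<notin> boundary_arcs VT" using not_boundary_arcs_I[OF z(1) _ ends(6)] by blast
    then show ?thesis using 2 x(4) by (auto simp: insert_commute)
  qed
qed

lemma triangle_tower:
  assumes "card W = 3" "finite W"
  shows "tower 0 W (D \<inter> diagonals W)"
proof -
  have d: "D \<inter> diagonals W = {}" using triangle_no_diagonals[OF assms(1)] by blast
  have sub: "subpolygons W {} = {W}" using subpolygons_empty assms by simp
  have "card {X. X = W \<and> y \<in> X} \<le> 2" for y
  proof -
    have "{X. X = W \<and> y \<in> X} \<subseteq> {W}" by blast
    then have "card {X. X = W \<and> y \<in> X} \<le> card {W}" by (intro card_mono) auto
    then show ?thesis by simp
  qed
  moreover have "{X. X = W \<and> card X = 3} = {W}" "{X. X = W \<and> card X = 4} = {}" using assms(1) by auto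
  moreover have "dissection W {}" by (simp add: dissection_def)
  ultimately show ?thesis
    using assms unfolding d tower_def tq_dissection_iff triangles_def quadrilaterals_def sub
    by simp
qed

text \<open>
  Cutting along \<open>DT\<close> leaves the triangles of \<open>VT\<close> except the one at \<open>{u, v}\<close>, and one more piece, which
  consists of \<open>VQ\<close> and the apex \<open>x\<close>. This piece is a tower because of the vertices of \<open>VQ\<close> the triangle
  meets only \<open>u\<close> and \<open>v\<close>, which belong to a single quadrilateral of the row.
\<close>

lemma decomposable_if_row:
  assumes "row VQ DQ u v"
  shows "tower_decomposable V D"
proof -
  obtain x where x: "x \<in> V" "cyclic3 v x u" and X: "{u, x, v} \<in> subpolygons VT DT"
    "{u, x} \<in> DT \<union> boundary_arcs VT" "{x, v} \<in> DT \<union> boundary_arcs VT"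
    by (rule base_triangle)
  define W0 where "W0 = insert x VQ"
  have W0V: "W0 \<subseteq> V" using x side_subset by (auto simp: W0_def)
  have finW0: "finite W0" using finite_subset[OF W0V fin] .
  have xVQ: "x \<notin> VQ" "x \<in> VT" using in_VT[OF x] by auto
  have dET: "dissection V DT" using dissection_mono[OF diss] by blast
  obtain k where k: "k \<in> V" "cyclic3 u k v" using dg(1) unfolding diagonals_iff by blast
  have kVQ: "k \<in> VQ" using in_VQ[OF k] by blast
  have W0: "\<exists>W'\<in>subpolygons V DT. W0 \<subseteq> W'"
    using arcs_of_DT_do_not_cut_tower[OF _ X(1)]
    by (intro subpolygon_containing[OF fin card3 dET W0V]) (auto simp: W0_def)
  \<comment> \<open>the only piece that reaches into the open quadrangulated side\<close>
  have big: "W = W0" if W: "W \<in> subpolygons V DT" "\<not> W \<subseteq> VT" for W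
  proof -
    have WV: "W \<subseteq> V" using W(1) by (auto simp: subpolygons_def)
    obtain y where y: "y \<in> W" "y \<notin> VT" using W(2) by blast
    then have yc: "cyclic3 u y v" using not_VT WV by blast
    have "z \<in> W0" if z: "z \<in> W" for z
    proof (rule ccontr)
      assume nz: "z \<notin> W0"
      then have "z \<in> VT" "z \<notin> {u, x, v}" using z WV side_Un(1)[OF dg(1)] ends by (auto simp: W0_def)
      then consider "cyclic3 x z u" "{x, u} \<in> DT" | "cyclic3 v z x" "{v, x} \<in> DT"
        using apex_cuts[OF x X(2,3)] by blast
      then show False
      proof cases
        case 1
        then have "W \<subseteq> side V x u \<or> W \<subseteq> side V u x"
          using subpolygon_subset_side[OF dET fin 1(2) W(1)] by blast
        then have "y \<in> side V x u \<or> z \<in> side V u x" using y z by blast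
        then show False using 1(1) yc x(2) unfolding side_def cyclic3_def mem_Collect_eq by (smt (verit))
      next
        case 2
        then have "W \<subseteq> side V v x \<or> W \<subseteq> side V x v"
          using subpolygon_subset_side[OF dET fin 2(2) W(1)] by blast
        then have "y \<in> side V v x \<or> z \<in> side V x v" using y z by blast
        then show False using 2(1) yc x(2) unfolding side_def cyclic3_def mem_Collect_eq by (smt (verit))
      qed
    qed
    then have "W \<subseteq> W0" by blast
    then show ?thesis using W0 subpolygons_eq_if_subset[OF fin W(1)] by blast
  qed
  have tower0: "tower (card (subpolygons VQ DQ)) W0 (D \<inter> diagonals W0)"
  proof -
    let ?D = "D \<inter> diagonals W0"
    have dW: "{u, v} \<in> diagonals W0"
      using k kVQ x ends unfolding diagonals_iff W0_def by blast
    have dissW: "dissection W0 ?D" using dissection_restrict[OF diss] .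
    have sides: "side W0 u v = VQ" "side W0 v u = {u, x, v}"
      using xVQ x ends in_VQ cyclic3_asym cyclic3_distinct unfolding W0_def side_def by blast+
    have DQ: "?D \<inter> diagonals VQ = DQ" using diagonals_mono[of VQ W0] by (auto simp: W0_def)
    have X3: "card {u, x, v} = 3" using tris X(1) by blast
    then have DX: "?D \<inter> diagonals {u, x, v} = {}" using triangle_no_diagonals by blast
    have subX: "subpolygons {u, x, v} {} = {{u, x, v}}" using subpolygons_empty X3 by simp
    have uvD: "{u, v} \<in> ?D" using dW uv by blast
    have sub: "subpolygons W0 ?D = insert {u, x, v} (subpolygons VQ DQ)"
      using subpolygons_split[OF dissW finW0 uvD] unfolding sides DQ DX subX by blast
    have "pieces_at W0 ?D y \<le> 2" if y: "y \<in> W0" for y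
    proof -
      have split: "pieces_at W0 ?D y = pieces_at VQ DQ y + pieces_at {u, x, v} {} y"
        using pieces_at_split[OF finW0 dissW uvD, of y] unfolding sides DQ DX .
      consider "y = u \<or> y = v" | "y = x" | "y \<notin> {u, x, v}" "y \<in> VQ" using y W0_def by blast
      then show ?thesis
      proof cases
        case 1
        then have "pieces_at {u, x, v} {} y = 1" using pieces_at_whole[of "{u, x, v}" "{}" y] subX by auto
        then show ?thesis using split 1 assms unfolding row_def by auto
      next
        case 2
        then have "pieces_at {u, x, v} {} y = 1" using pieces_at_whole[of "{u, x, v}" "{}" y] subX by auto
        then show ?thesis using split 2 pieces_at_outside[OF xVQ(1)] by simp
      next
        case 3
        have "pieces_at {u, x, v} {} y = 0" by (rule pieces_at_outside[OF 3(1)])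
        moreover have "pieces_at VQ DQ y \<le> 2" using assms 3(2) unfolding row_def by blast
        ultimately show ?thesis using split by simp
      qed
    qed
    moreover have "triangles W0 ?D = {{u, x, v}}" "quadrilaterals W0 ?D = subpolygons VQ DQ"
      unfolding triangles_def quadrilaterals_def sub using quads X3 by force+
    moreover have "card W0 = 2 * card (subpolygons VQ DQ) + 3"
      using card_quadrangulated[OF finite_sides(1) card_side(2)[OF dg(1) fin] dissection_restrict[OF diss] quads]
        xVQ(1) finite_sides(1) unfolding W0_def by simp
    moreover have "tq_dissection W0 ?D"
      using dissW quads X3 unfolding tq_dissection_iff sub by blast
    ultimately show ?thesis using finW0 unfolding tower_def pieces_at_def by simp
  qed
  have "\<exists>m. tower m W (D \<inter> diagonals W)" if W: "W \<in> subpolygons V DT" for W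
  proof (cases "W \<subseteq> VT")
    case False
    then show ?thesis using big[OF W] tower0 by blast
  next
    case True
    have "DT \<inter> diagonals VT = DT" by blast
    then have "W \<in> subpolygons VT DT" using subpolygons_restrict[OF W True side_subset] by simp
    then have "card W = 3" using tris by blast
    then show ?thesis using triangle_tower card_ge_0_finite[of W] by auto
  qed
  then show ?thesis unfolding tower_decomposable_def by blast
qed

section \<open>Unitarity\<close>

lemma frieze_sides:
  assumes "dissection_frieze V D f"
  shows "dissection_frieze VQ DQ f" "dissection_frieze VT DT f"
  using dissection_frieze_side[OF assms fin diss uv] dissection_frieze_side[OF assms fin diss vu] by auto

lemma VT_positive_integer:
  assumes "dissection_frieze V D f" "i \<in> VT" "j \<in> VT" "i \<noteq> j"
  obtains k where "f i j = of_int k" "k > 0"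
  using triangulated_frieze_positive_integer[OF finite_sides(2) card_side(2)[OF dg(2) fin] dissection_restrict[OF diss] tris
      frieze_sides(2)[OF assms(1)] assms(2-4)] .

text \<open>
  The hypotheses place \<open>x\<close> and \<open>y\<close> strictly inside \<open>VT\<close> and \<open>VQ\<close>.
\<close>

lemma transversal:
  assumes "x \<in> V" "cyclic3 v x u" "y \<in> V" "cyclic3 u y v"
  shows "{x, y} \<in> diagonals V" "crossing {u, v} {x, y}"
proof -
  show "crossing {u, v} {x, y}" using assms unfolding crossing_iff by blast
  then show "{x, y} \<in> diagonals V" using crossing_diagonals[of u v x y V] assms ends by auto
qed

text \<open>
  The triangulation by units consists of \<open>DT\<close>, where \<open>f\<close> is 1, and of the fan from the apex \<open>x\<close>. Most
  of the proof is the maximality of this set: an arc that crosses no arc of it is in \<open>DT\<close> if it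
  stays in \<open>VT\<close>; it would cross an arc of the fan if it stayed in \<open>VQ\<close>; and if it passes from one side to the
  other, it starts at \<open>x\<close>, because every other vertex of \<open>VT\<close> is screened off by \<open>{x, u}\<close> or \<open>{v, x}\<close>.
\<close>

lemma unitary_if_units:
  assumes F: "dissection_frieze V D f" and units: "\<forall>y\<in>VQ. f y u + f y v dvd 1"
  shows "unitary V f"
proof -
  obtain x where x: "x \<in> V" "cyclic3 v x u" and X: "{u, x, v} \<in> subpolygons VT DT"
    "{u, x} \<in> DT \<union> boundary_arcs VT" "{x, v} \<in> DT \<union> boundary_arcs VT"
    "{u, x} \<in> boundary_arcs {u, x, v}" "{x, v} \<in> boundary_arcs {u, x, v}"
    by (rule base_triangle)
  have xVT: "x \<in> VT" "x \<notin> VQ" using in_VT[OF x] by auto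
  define fan where "fan = {{x, y} |y. y \<in> V \<and> cyclic3 u y v}"
  define T where "T = DT \<union> fan"
  obtain k where k: "k \<in> V" "cyclic3 u k v" using dg(1) unfolding diagonals_iff by blast
  have "{u, x, v} \<in> subpolygons V D" using X(1) pieces by blast
  then have f1: "f u x = 1" "f x v = 1" using dissection_frieze_D(6)[OF F] X(4,5) by blast+
  have fan_unit: "f x y dvd 1 \<and> f y x dvd 1" if y: "y \<in> V" "cyclic3 u y v" for y
  proof -
    have yVQ: "y \<in> VQ" using in_VQ[OF y] by blast
    have "f y x = f y u * f x v + f y v * f x u"
      by (rule dissection_frieze_across[OF F fin diss uv yVQ xVT(1)])
    moreover have "f x u = 1" "f x y = f y x"
      using f1 dissection_frieze_D(2)[OF F] x(1) ends(1) y(1) by metis+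
    ultimately show ?thesis using units yVQ f1 by simp
  qed
  have T_unit: "f i j dvd 1" if ij: "{i, j} \<in> T" for i j
  proof -
    consider "{i, j} \<in> DT" | "{i, j} \<in> fan" using ij unfolding T_def by blast
    then show ?thesis
    proof cases
      case 1 then show ?thesis using dissection_frieze_arc[OF F fin diss, of i j] by simp
    next
      case 2
      then obtain y where "{i, j} = {x, y}" "y \<in> V" "cyclic3 u y v" unfolding fan_def by blast
      then show ?thesis using fan_unit[of y] by (auto simp: doubleton_eq_iff)
    qed
  qed
  have fan_fan: "\<not> crossing a b" if ab: "a \<in> fan" "b \<in> fan" for a b
  proof -
    obtain y z where "a = {x, y}" "b = {x, z}" using ab unfolding fan_def by blast
    then show ?thesis using cyclic3_distinct by (auto simp: crossing_iff)
  qed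
  have DT_fan: "\<not> crossing a b \<and> \<not> crossing b a" if ab: "a \<in> DT" "b \<in> fan" for a b
  proof -
    obtain y where y: "b = {x, y}" "y \<in> V" "cyclic3 u y v" using ab(2) unfolding fan_def by blast
    have "a \<in> diagonals VT" using ab(1) by blast
    then obtain i j where a: "a = {i, j}" by (rule diagonalE)
    have yx: "x \<in> insert x VQ" "y \<in> insert x VQ" using in_VQ[OF y(2,3)] by auto
    have "{i, j} \<in> DT" "{j, i} \<in> DT" using ab(1) a by (simp_all add: insert_commute)
    then consider "x \<in> side V i j" "y \<in> side V i j" | "x \<in> side V j i" "y \<in> side V j i"
      using arcs_of_DT_do_not_cut_tower[OF _ X(1), of i j] yx by blast
    then have "\<not> crossing {i, j} {x, y}"
    proof cases
      case 1 then show ?thesis by (rule subset_side_not_crossing)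
    next
      case 2 then have "\<not> crossing {j, i} {x, y}" by (rule subset_side_not_crossing)
      then show ?thesis by (simp add: insert_commute)
    qed
    then show ?thesis using crossing_commute a y(1) by metis
  qed
  have fan_diag: "fan \<subseteq> diagonals V" using transversal(1)[OF x] unfolding fan_def by blast
  have DT_DT: "\<not> crossing a b" if "a \<in> DT" "b \<in> DT" for a b
    using that diss unfolding dissection_def by blast
  have "dissection V T"
    unfolding dissection_def
  proof (intro conjI ballI)
    show "T \<subseteq> diagonals V" using fan_diag diss unfolding T_def dissection_def by blast
  next
    fix a b assume "a \<in> T" "b \<in> T"
    then show "\<not> crossing a b" unfolding T_def using fan_fan DT_fan DT_DT by blast
  qed
  moreover have "T' \<subseteq> T" if T': "dissection V T'" "T \<subseteq> T'" for T'
  proof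
    fix t assume t: "t \<in> T'"
    then have td: "t \<in> diagonals V" using T'(1) by (auto simp: dissection_def)
    have nc: "\<not> crossing s t \<and> \<not> crossing t s" if "s \<in> T" for s
      using T' t that unfolding dissection_def by blast
    show "t \<in> T"
    proof (cases "crossing {u, v} t")
      case True
      obtain i j where ij: "t = {i, j}" "i \<in> V" "j \<in> V" using td by (rule diagonalE)
      have "\<exists>a b. t = {a, b} \<and> a \<in> V \<and> b \<in> V \<and> cyclic3 v a u \<and> cyclic3 u b v"
        using True ij unfolding ij(1) crossing_iff by (metis insert_commute)
      then obtain a b where ab: "t = {a, b}" "a \<in> V" "b \<in> V" "cyclic3 v a u" "cyclic3 u b v" by blast
      show ?thesis
      proof (cases "a = x")
        case True
        then show ?thesis using ab unfolding T_def fan_def by blast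
      next
        case False
        have "a \<in> VT" "a \<notin> {u, x, v}" using in_VT[OF ab(2,4)] ab(4) False cyclic3_distinct by blast+
        then consider "cyclic3 x a u" "{x, u} \<in> DT" | "cyclic3 v a x" "{v, x} \<in> DT"
          using apex_cuts[OF x X(2,3)] by blast
        then have False
        proof cases
          case 1
          have "crossing {x, u} {a, b}" using 1(1) ab(5) x(2) unfolding crossing_iff cyclic3_def by (smt (verit))
          then show False using nc[of "{x, u}"] 1(2) ab(1) unfolding T_def by blast
        next
          case 2
          have "crossing {v, x} {a, b}" using 2(1) ab(5) x(2) unfolding crossing_iff cyclic3_def by (smt (verit))
          then show False using nc[of "{v, x}"] 2(2) ab(1) unfolding T_def by blast
        qed
        then show ?thesis ..
      qed
    next
      case False
      have xk: "{x, k} \<in> T" using k unfolding T_def fan_def by blast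
      consider "t = {u, v}" | "t \<in> diagonals VQ" | "t \<in> diagonals VT"
        using diagonal_partition[OF dg(1) td False] by blast
      then show ?thesis
      proof cases
        case 1
        then show ?thesis using nc[OF xk] transversal(2)[OF x k] by blast
      next
        case 2
        then obtain a b where ab: "t = {a, b}" "a \<in> VQ" "b \<in> VQ" "{a, b} \<in> diagonals VQ" by (rule diagonalE)
        \<comment> \<open>vertices on either side of \<open>{a, b}\<close>; the one that \<open>{a, b}\<close> separates from \<open>x\<close> is not an end point of \<open>{u, v}\<close>\<close>
        obtain k1 k2 where kk: "k1 \<in> VQ" "cyclic3 a k1 b" "k2 \<in> VQ" "cyclic3 b k2 a"
          using ab(4) unfolding diagonals_iff by blast
        have abc: "a = u \<or> a = v \<or> cyclic3 u a v" "b = u \<or> b = v \<or> cyclic3 u b v"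
          "k1 = u \<or> k1 = v \<or> cyclic3 u k1 v" "k2 = u \<or> k2 = v \<or> cyclic3 u k2 v"
          using ab kk by (auto simp: side_def)
        have "cyclic3 u k1 v \<and> crossing {x, k1} {a, b} \<or> cyclic3 u k2 v \<and> crossing {x, k2} {a, b}"
          using abc kk(2,4) x(2) unfolding crossing_iff cyclic3_def by (smt (verit))
        moreover have "k1 \<in> V" "k2 \<in> V" using kk side_subset by blast+
        ultimately show ?thesis using nc ab(1) unfolding T_def fan_def by blast
      next
        case 3
        have "triangulation VT DT"
          by (rule triangulation_if_all_triangles[OF finite_sides(2) card_side(2)[OF dg(2) fin] dissection_restrict[OF diss] tris])
        moreover have "DT \<subseteq> T' \<inter> diagonals VT" using T'(2) unfolding T_def by blast
        ultimately have "T' \<inter> diagonals VT = DT"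
          using dissection_restrict[OF T'(1)] unfolding triangulation_def by blast
        then show ?thesis using 3 t unfolding T_def by blast
      qed
    qed
  qed
  ultimately have "triangulation V T" unfolding triangulation_def by blast
  then show ?thesis unfolding unitary_def using T_unit by blast
qed

text \<open>
  Every edge of \<open>VQ\<close> except \<open>{u, v}\<close> is an edge of the polygon and so belongs to a triangle of \<open>T\<close>, whose apex lies
  strictly inside \<open>VT\<close>. The edges \<open>{u, p}\<close> and \<open>{q, v}\<close> determine the apex \<open>z\<close> by \<open>f z u = f z v = 1\<close>; the arcs from
  \<open>z\<close> to \<open>p\<close> and \<open>q\<close> then leave no other apex for the edges between \<open>p\<close> and \<open>q\<close>.
\<close>

lemma units_if_unitary:
  assumes F: "dissection_frieze V D f" and unit: "unitary V f"
    and Q: "{u, p, q, v} \<in> subpolygons VQ DQ" "cyclic4 u p q v"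
    and bdQ: "{u, p} \<in> boundary_arcs V" "{q, v} \<in> boundary_arcs V"
  shows "\<forall>y\<in>VQ. f y u + f y v dvd 1"
proof -
  obtain T where T: "triangulation V T" "\<And>i j. {i, j} \<in> T \<Longrightarrow> f i j dvd 1"
    using unit unfolding unitary_def by blast
  have dT: "dissection V T" using T(1) by (simp add: triangulation_def)
  have unitTB: "f i j dvd 1" if "{i, j} \<in> T \<union> boundary_arcs V" for i j
    using that T(2) dissection_frieze_D(1)[OF F] by auto
  note sym = dissection_frieze_D(2)[OF F]
  have apex: "\<exists>z. z \<in> V \<and> cyclic3 v z u \<and> f z y dvd 1 \<and> f z y' dvd 1 \<and>
      {y, z} \<in> T \<union> boundary_arcs V \<and> {y', z} \<in> T \<union> boundary_arcs V"
    if yy: "{y, y'} \<in> boundary_arcs V" "y \<in> VQ" "y' \<in> VQ" for y y'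
  proof -
    obtain z where z: "z \<in> V" "z \<noteq> y" "z \<noteq> y'" "{y, z} \<in> T \<union> boundary_arcs V" "{y', z} \<in> T \<union> boundary_arcs V"
      using triangulation_apex[OF fin card3 T(1) yy(1)] .
    have un: "f y z dvd 1" "f y' z dvd 1" "f y y' dvd 1"
      using unitTB z(4,5) yy(1) by blast+
    have "z \<notin> VQ"
    proof
      assume "z \<in> VQ"
      then show False
        using no_unit_triangle_in_quadrangulation[OF finite_sides(1) card_side(2)[OF dg(1) fin]
            dissection_restrict[OF diss] quads frieze_sides(1)[OF F] yy(2,3) _ un(3,2,1)] by blast
    qed
    moreover have "y \<in> V" "y' \<in> V" using yy side_subset by blast+
    ultimately show ?thesis using un z not_VQ[OF z(1)] sym[OF z(1)] by metis
  qed
  have QV: "u \<in> VQ" "p \<in> VQ" "q \<in> VQ" "v \<in> VQ" using Q(1) by (auto simp: subpolygons_def)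
  have pqV: "p \<in> V" "q \<in> V" using QV side_subset by blast+
  have ord: "cyclic3 u p v" "cyclic3 u q v" "cyclic3 u p q" "cyclic3 p q v"
    using Q(2) unfolding cyclic4_iff cyclic3_def by (smt (verit))+
  have QD: "{u, p, q, v} \<in> subpolygons V D" using Q(1) pieces by blast
  have ne: "u \<noteq> p" "u \<noteq> q" "u \<noteq> v" "p \<noteq> q" "p \<noteq> v" "q \<noteq> v" using ord cyclic3_distinct by blast+
  have Q4: "card {u, p, q, v} = 4" using ne by simp
  have fQ: "f p u = 1" "f p v = sqrt2" "f q v = 1" "f q u = sqrt2"
    using dissection_frieze_D(6)[OF F QD] dissection_frieze_D(7)[OF F QD Q4]
    unfolding quad_arcs[OF Q(2)] by (simp_all add: insert_commute)
  have across: "f z y = f y v * f z u + f y u * f z v" if "z \<in> V" "cyclic3 v z u" "y \<in> VQ" for z y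
  proof -
    have "f y z = f y u * f z v + f y v * f z u"
      using dissection_frieze_across[OF F fin diss uv that(3)] in_VT[OF that(1,2)] by blast
    then show ?thesis using sym[of z y] that side_subset by (metis add.commute subsetD)
  qed
  have ints: "\<exists>k l. f z u = of_int k \<and> k > 0 \<and> f z v = of_int l \<and> l > 0" if z: "z \<in> V" "cyclic3 v z u" for z
  proof -
    have "z \<in> VT" "z \<noteq> u" "z \<noteq> v" using in_VT[OF z] cyclic3_distinct[OF z(2)] by auto
    then show ?thesis
      using VT_positive_integer[OF F, of z u] VT_positive_integer[OF F, of z v] ends by metis
  qed
  obtain z1 where z1: "z1 \<in> V" "cyclic3 v z1 u" "f z1 u dvd 1" "f z1 p dvd 1" "{p, z1} \<in> T \<union> boundary_arcs V"
    using apex[OF bdQ(1) QV(1,2)] by blast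
  obtain z2 where z2: "z2 \<in> V" "cyclic3 v z2 u" "f z2 q dvd 1" "f z2 v dvd 1" "{q, z2} \<in> T \<union> boundary_arcs V"
    using apex[OF bdQ(2) QV(3,4)] by blast
  have one1: "f z1 u = 1 \<and> f z1 v = 1"
  proof -
    obtain k l where kl: "f z1 u = of_int k" "k > 0" "f z1 v = of_int l" "l > 0" using ints[OF z1(1,2)] by blast
    then have "k = 1" using unit_of_int z1(3) by simp
    then have "f z1 p = of_int l + sqrt2" using across[OF z1(1,2) QV(2)] kl fQ by (simp add: add.commute)
    then have "l = 1" using unit_of_int_plus_sqrt2 z1(4) kl by simp
    then show ?thesis using kl \<open>k = 1\<close> by simp
  qed
  have one2: "f z2 u = 1 \<and> f z2 v = 1"
  proof -
    obtain k l where kl: "f z2 u = of_int k" "k > 0" "f z2 v = of_int l" "l > 0" using ints[OF z2(1,2)] by blast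
    then have "l = 1" using unit_of_int z2(4) by simp
    then have "f z2 q = of_int k + sqrt2" using across[OF z2(1,2) QV(3)] kl fQ by (simp add: add.commute)
    then have "k = 1" using unit_of_int_plus_sqrt2 z2(3) kl by simp
    then show ?thesis using kl \<open>l = 1\<close> by simp
  qed
  \<comment> \<open>Ptolemy for \<open>{v, b}\<close> and \<open>{a, u}\<close> reads \<open>1 = f b a + 1\<close>\<close>
  have uniq: False if ab: "a \<in> V" "b \<in> V" "f a u = 1" "f a v = 1" "f b u = 1" "f b v = 1"
      "cyclic3 v a b" "cyclic3 a b u" "cyclic3 v b u" for a b
  proof -
    have "crossing {v, b} {a, u}" using ab(7-9) ends(3) unfolding crossing_iff cyclic3_def by (smt (verit))
    then have "f v b * f a u = f v u * f b a + f v a * f b u"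
      using dissection_frieze_D(5)[OF F] ab(1,2) ends(1,2) by auto
    moreover have "f v u = 1" by (rule dissection_frieze_arc[OF F fin diss vu])
    moreover have "f v b = 1" "f v a = 1" using sym ab ends(2) by metis+
    ultimately have "f b a = 0" using ab by simp
    then have "b = a" using dissection_frieze_D(4)[OF F ab(2,1)] by blast
    then show False using ab(7) cyclic3_distinct by blast
  qed
  have z12: "z1 = z2"
  proof (rule ccontr)
    assume "z1 \<noteq> z2"
    then have "cyclic3 v z1 z2 \<and> cyclic3 z1 z2 u \<or> cyclic3 v z2 z1 \<and> cyclic3 z2 z1 u"
      using z1(2) z2(2) unfolding cyclic3_def by (smt (verit))
    then show False using uniq[of z1 z2] uniq[of z2 z1] one1 one2 z1 z2 by blast
  qed
  have inT: "{y, z} \<in> T" if "{y, z} \<in> T \<union> boundary_arcs V" "z \<in> V" "cyclic3 v z u" "y \<in> V" "cyclic3 u y v" for y z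
    using that transversal(1)[OF that(2-5)] diagonals_not_boundary by (auto simp: insert_commute)
  have pT: "{p, z1} \<in> T" using inT[OF z1(5,1,2) pqV(1) ord(1)] .
  have qT: "{q, z1} \<in> T" using inT[OF z2(5,1,2) pqV(2) ord(2)] z12 by simp
  have noncross: "\<not> crossing a b" if "a \<in> T" "b \<in> T" for a b
    using dT that unfolding dissection_def by blast
  have main: "f z1 y dvd 1" if y: "y \<in> VQ" "y \<noteq> u" "y \<noteq> v" for y
  proof (cases "y = p \<or> y = q")
    case True
    then show ?thesis using z1(4) z2(3) z12 by auto
  next
    case False
    have yV: "y \<in> V" "cyclic3 u y v" using y by (auto simp: side_def)
    obtain y' where y': "y' \<in> VQ" "y' \<noteq> y" "\<And>k. k \<in> VQ \<Longrightarrow> \<not> cyclic3 y k y'"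
      using next_vertex[of VQ y] finite_sides(1) card_side(2)[OF dg(1) fin] y(1) by auto
    then have "{y, y'} \<in> boundary_arcs VQ" using y(1) by (intro boundary_arcs_I) auto
    moreover have "{y, y'} \<noteq> {u, v}" using y by (auto simp: doubleton_eq_iff)
    ultimately have "{y, y'} \<in> boundary_arcs V" using boundary_arcs_side[OF dg(1), of y y'] by blast
    then obtain z where z: "z \<in> V" "cyclic3 v z u" "f z y dvd 1" "{y, z} \<in> T \<union> boundary_arcs V"
      using apex[of y y'] y(1) y'(1) by blast
    have zT: "{y, z} \<in> T" using inT[OF z(4,1,2) yV] .
    \<comment> \<open>nothing lies behind the edges \<open>{u, p}\<close> and \<open>{q, v}\<close>, so \<open>y\<close> is between \<open>p\<close> and \<open>q\<close>\<close>
    have "\<not> cyclic3 u y p"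
      using bdQ(1) not_boundary_arcs_I[OF yV(1), of u p q] pqV ord cyclic3_rotate by blast
    moreover have "\<not> cyclic3 q y v"
      using bdQ(2) not_boundary_arcs_I[OF yV(1), of q v p] pqV ord cyclic3_rotate by blast
    ultimately have "z = z1 \<or> crossing {p, z1} {y, z} \<or> crossing {q, z1} {y, z}"
      using ord yV(2) z(2) z1(2) False unfolding crossing_iff cyclic3_def by (smt (verit))
    then have "z = z1" using noncross[OF pT zT] noncross[OF qT zT] by blast
    then show ?thesis using z(3) by simp
  qed
  show ?thesis
  proof
    fix y assume y: "y \<in> VQ"
    consider "y = u" | "y = v" | "y \<noteq> u" "y \<noteq> v" by blast
    then show "f y u + f y v dvd 1"
    proof cases
      case 1
      then show ?thesis using dissection_frieze_D(3)[OF F ends(1)] dissection_frieze_arc[OF F fin diss uv] by simp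
    next
      case 2
      then show ?thesis using dissection_frieze_D(3)[OF F ends(2)] dissection_frieze_arc[OF F fin diss vu] by simp
    next
      case 3
      then have "f y v + f y u dvd 1" using main[OF y 3] across[OF z1(1,2) y] one1 by simp
      then show ?thesis by (simp add: add.commute)
    qed
  qed
qed

end

section \<open>The arc of a separated dissection and the equivalence\<close>

text \<open>
  No arc strictly inside a side of \<open>\<tau>\<close> is mixed, so each side has pieces of one kind only; the labels of
  the quadrilateral at \<open>\<tau>\<close> are shifted such that it lies on the side from \<open>u\<close> to \<open>v\<close>.
\<close>

lemma separated_cut:
  assumes "finite V" "card V \<ge> 3" "tq_dissection V D" "separated V D"
  obtains u v p q where "cut_dissection V D u v" "cyclic4 u p q v"
    "{u, p, q, v} \<in> subpolygons (side V u v) (D \<inter> diagonals (side V u v))"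
    "{u, p} \<in> boundary_arcs V" "{q, v} \<in> boundary_arcs V"
proof -
  have D: "dissection V D" using assms(3) by (simp add: tq_dissection_iff)
  obtain \<tau> where \<tau>: "{a \<in> D. (\<exists>W\<in>triangles V D. a \<in> boundary_arcs W) \<and>
                (\<exists>Q\<in>quadrilaterals V D. a \<in> boundary_arcs Q)} = {\<tau>}"
    and quad: "\<forall>Q\<in>quadrilaterals V D. \<tau> \<in> boundary_arcs Q \<longrightarrow>
           (\<exists>p q r s. Q = {p, q, r, s} \<and> cyclic4 p q r s \<and> \<tau> = {p, q} \<and>
              {q, r} \<in> boundary_arcs V \<and> {s, p} \<in> boundary_arcs V)"
    using assms(4) unfolding separated_def by (elim exE conjE) (rule that)
  have "\<tau> \<in> {a \<in> D. (\<exists>W\<in>triangles V D. a \<in> boundary_arcs W) \<and>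
      (\<exists>Q\<in>quadrilaterals V D. a \<in> boundary_arcs Q)}" unfolding \<tau> by simp
  then obtain W Q where W: "W \<in> triangles V D" "\<tau> \<in> boundary_arcs W"
    and Q: "Q \<in> quadrilaterals V D" "\<tau> \<in> boundary_arcs Q"
    and \<tau>D: "\<tau> \<in> D" by blast
  obtain v u p q where Q': "Q = {v, u, p, q}" "cyclic4 v u p q" "\<tau> = {v, u}"
    "{u, p} \<in> boundary_arcs V" "{q, v} \<in> boundary_arcs V"
    using bspec[OF quad Q(1)] Q(2) by (elim impE exE conjE) auto
  have cyc: "cyclic4 u p q v" using Q'(2) unfolding cyclic4_def by blast
  have uvD: "{u, v} \<in> D" using \<tau>D Q'(3) by (simp add: insert_commute)
  then have dg: "{u, v} \<in> diagonals V" "{v, u} \<in> diagonals V"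
    using D by (auto simp: dissection_def insert_commute)
  let ?A = "side V u v" and ?B = "side V v u"
  let ?DA = "D \<inter> diagonals ?A" and ?DB = "D \<inter> diagonals ?B"
  note sp = subpolygons_split[OF D assms(1) uvD]
  have fin: "finite ?A" "finite ?B" using finite_subset[OF side_subset assms(1)] by auto
  have uniform: "(\<forall>W\<in>subpolygons (side V x y) (D \<inter> diagonals (side V x y)). card W = 3) \<or>
      (\<forall>W\<in>subpolygons (side V x y) (D \<inter> diagonals (side V x y)). card W = 4)"
    if xy: "{x, y} = {u, v}" for x y
  proof -
    have d: "{x, y} \<in> diagonals V" "{x, y} \<in> D" using xy dg uvD by auto
    have sub: "subpolygons (side V x y) (D \<inter> diagonals (side V x y)) \<subseteq> subpolygons V D"
      using subpolygons_split[OF D assms(1) d(2)] by blast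
    have "\<tau> \<notin> diagonals (side V x y)"
      using diagonals_side[OF d(1), of u v] xy Q'(3) by (auto simp: insert_commute)
    then have "\<not> (\<exists>a\<in>D \<inter> diagonals (side V x y). (\<exists>W\<in>triangles (side V x y) (D \<inter> diagonals (side V x y)). a \<in> boundary_arcs W) \<and>
       (\<exists>Q\<in>quadrilaterals (side V x y) (D \<inter> diagonals (side V x y)). a \<in> boundary_arcs Q))"
    proof -
      have "a = \<tau>" if "a \<in> D" "\<exists>W\<in>triangles V D. a \<in> boundary_arcs W"
        "\<exists>Q\<in>quadrilaterals V D. a \<in> boundary_arcs Q" for a
      proof -
        have "a \<in> {a \<in> D. (\<exists>W\<in>triangles V D. a \<in> boundary_arcs W) \<and>
            (\<exists>Q\<in>quadrilaterals V D. a \<in> boundary_arcs Q)}" using that by simp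
        then show ?thesis unfolding \<tau> by simp
      qed
      then show ?thesis
        using sub \<open>\<tau> \<notin> diagonals (side V x y)\<close> unfolding triangles_def quadrilaterals_def by blast
    qed
    then show ?thesis
      using uniform_or_mixed_arc[OF finite_subset[OF side_subset assms(1)] card_side(2)[OF d(1) assms(1)]
          dissection_restrict[OF D] tq_dissection_side(1)[OF assms(3,1) d(2)]] by blast
  qed
  have QV: "Q \<in> subpolygons V D" "card Q = 4" using Q(1) by (auto simp: quadrilaterals_def)
  have WV: "W \<in> subpolygons V D" "card W = 3" using W(1) by (auto simp: triangles_def)
  have "p \<notin> ?B" using cyc by (auto simp: side_def cyclic4_def cyclic3_def)
  then have "Q \<notin> subpolygons ?B ?DB" using Q'(1) by (auto simp: subpolygons_def)
  then have QA: "Q \<in> subpolygons ?A ?DA" using QV(1) sp by blast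
  then have A4: "\<forall>W\<in>subpolygons ?A ?DA. card W = 4" using uniform[of u v] QV(2) by fastforce
  then have "W \<notin> subpolygons ?A ?DA" using WV(2) by fastforce
  then have "W \<in> subpolygons ?B ?DB" using WV(1) sp by blast
  then have B3: "\<forall>W\<in>subpolygons ?B ?DB. card W = 3" using uniform[of v u] WV(2) by fastforce
  have "cut_dissection V D u v"
    using assms(1,2) D uvD A4 B3 by unfold_locales
  moreover have "{u, p, q, v} \<in> subpolygons ?A ?DA"
    using QA Q'(1) by (simp add: insert_commute)
  ultimately show ?thesis using that cyc Q'(4,5) by blast
qed

theorem proposition3:
  fixes n :: nat and D :: "nat set set"
  assumes "n \<ge> 3"
    and "tq_dissection {..<n} D"
    and "separated {..<n} D"
  shows "unitary {..<n} (frieze_of {..<n} D) \<longleftrightarrow> tower_decomposable {..<n} D"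
proof -
  let ?V = "{..<n}" and ?f = "frieze_of {..<n} D"
  have V: "finite ?V" "card ?V \<ge> 3" using assms(1) by auto
  obtain u v p q where cut: "cut_dissection ?V D u v" and Q: "cyclic4 u p q v"
    "{u, p, q, v} \<in> subpolygons (side ?V u v) (D \<inter> diagonals (side ?V u v))"
    "{u, p} \<in> boundary_arcs ?V" "{q, v} \<in> boundary_arcs ?V"
    using separated_cut[OF V assms(2,3)] .
  interpret cut_dissection ?V D u v by (rule cut)
  have F: "dissection_frieze ?V D ?f" by (rule dissection_frieze_frieze_of[OF V assms(2)])
  have "unitary ?V ?f \<longleftrightarrow> (\<forall>y\<in>VQ. ?f y u + ?f y v dvd 1)"
    using unitary_if_units[OF F] units_if_unitary[OF F _ Q(2,1,3,4)] by blast
  also have "\<dots> \<longleftrightarrow> row VQ DQ u v"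
    using row_iff_units[OF finite_sides(1) card_side(2)[OF dg(1) fin] dissection_restrict[OF diss] quads
        frieze_sides(1)[OF F], of u v] boundary_arcs_side[OF dg(1), of u v] by simp
  also have "\<dots> \<longleftrightarrow> tower_decomposable ?V D"
    using row_if_decomposable decomposable_if_row by blast
  finally show ?thesis .
qed

end
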